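(* Let $n,k\in\mathbb N$, $k>n$, with $n$ and $k$ relatively prime. Then: (i) $\mathcal G^{\mathbb R}_{k,n}$ is a regular, real analytic submanifold of $M_k(\mathbb R)$ of dimension $\dim(\mathcal G^{\mathbb R}_{k,n})=(k-n-1)(n-1)$; (ii) $\mathcal F^{\mathbb R}_{k,n}$ is a regular, real analytic submanifold of $(S^{n-1})^k$ of dimension $\dim(\mathcal F^{\mathbb R}_{k,n})=(k-\frac n2-1)(n-1)$; (iii) $\mathcal G^{\mathbb C}_{k,n}$ is a regular, real analytic submanifold of $M_k(\mathbb C)$ of dimension $\dim(\mathcal G^{\mathbb C}_{k,n})=2n(k-n)-k+1$; (iv) $\mathcal F^{\mathbb C}_{k,n}$ is a regular, real analytic submanifold of $(S^{2n-1})^k$ of dimension $\dim(\mathcal F^{\mathbb C}_{k,n})=2n(k-n)+n^2-k+1$.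
   Context: "Regular submanifold" means embedded submanifold; all dimensions are real dimensions, and $M_k(\mathbb C)$ is regarded as a real vector space. Let $\mathbb E=\mathbb R$ or $\mathbb C$. $\mathcal F^{\mathbb E}_{k,n}$ is the space of all ordered lists $F=(f_1,\dots,f_k)$ of unit vectors in $\mathbb E^n$ that are tight frames for $\mathbb E^n$, i.e. for which there is $B>0$ with $\sum_{i=1}^k|\langle v,f_i\rangle|^2=B\|v\|^2$ for all $v\in\mathbb E^n$; it is regarded as a subset of the $k$-fold product of the unit sphere of $\mathbb E^n$ ($S^{n-1}$ for $\mathbb R^n$, $S^{2n-1}$ for $\mathbb C^n$). $\mathcal G^{\mathbb E}_{k,n}=\{\frac kn P\mid P\in M_k(\mathbb E)$ a projection (self-adjoint idempotent) of rank $n$, $P_{ii}=\frac nk$ for $1\le i\le k\}$. *)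

theory Defs
  imports "HOL-Analysis.Analysis"
begin

section \<open>Real analytic maps and submanifolds of Euclidean space\<close>

text \<open>
  Near the point, the map is the sum of a convergent power series in the coordinates with
  respect to \<open>Basis\<close>; the multi-indices are the functions from \<open>Basis\<close> to the naturals.
\<close>

definition real_analytic_at :: "('a::euclidean_space \<Rightarrow> 'b::euclidean_space) \<Rightarrow> 'a \<Rightarrow> bool" where
  "real_analytic_at f x \<longleftrightarrow>
    (\<exists>c. \<forall>\<^sub>F y in nhds x.
       ((\<lambda>\<alpha>::'a \<Rightarrow> nat. (\<Prod>b\<in>Basis. ((y - x) \<bullet> b) ^ \<alpha> b) *\<^sub>R c \<alpha>) has_sum f y)
         (Basis \<rightarrow>\<^sub>E UNIV))"

text \<open>On a set that need not be open, analyticity means having local analytic extensions.\<close>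

definition real_analytic_map_on :: "('a::euclidean_space \<Rightarrow> 'b::euclidean_space) \<Rightarrow> 'a set \<Rightarrow> bool" where
  "real_analytic_map_on f A \<longleftrightarrow>
    (\<forall>x\<in>A. \<exists>U g. open U \<and> x \<in> U \<and> (\<forall>y\<in>U. real_analytic_at g y) \<and> (\<forall>y\<in>U \<inter> A. f y = g y))"

definition analytic_diffeo :: "('a::euclidean_space \<Rightarrow> 'b::euclidean_space) \<Rightarrow> 'a set \<Rightarrow> 'b set \<Rightarrow> bool" where
  "analytic_diffeo f U V \<longleftrightarrow>
    bij_betw f U V \<and> real_analytic_map_on f U \<and> real_analytic_map_on (inv_into U f) V"

text \<open>
  A chart of a set \<open>M\<close> carrying the analytic structure induced by the ambient Euclidean space.
  A linear subspace \<open>W\<close> of the ambient space plays the role of the model space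
  \<open>\<real>\<^sup>m\<close>, \<open>m = dim W\<close>.
\<close>

definition analytic_chart ::
  "'a::euclidean_space set \<Rightarrow> 'a set \<Rightarrow> ('a \<Rightarrow> 'a) \<Rightarrow> 'a set \<Rightarrow> 'a set \<Rightarrow> bool" where
  "analytic_chart M U \<phi> V W \<longleftrightarrow>
    openin (top_of_set M) U \<and> subspace W \<and> openin (top_of_set W) V \<and> analytic_diffeo \<phi> U V"

text \<open>
  Regular (that is, embedded) analytic submanifolds, via slice charts of \<open>M\<close>. The set is required
  to be nonempty because only then is its dimension \<open>d\<close> determined.
\<close>

definition regular_analytic_submanifold :: "nat \<Rightarrow> 'a::euclidean_space set \<Rightarrow> 'a set \<Rightarrow> bool" where
  "regular_analytic_submanifold d S M \<longleftrightarrow>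
    S \<noteq> {} \<and> S \<subseteq> M \<and>
    (\<forall>p\<in>S. \<exists>U \<phi> V W L. p \<in> U \<and> analytic_chart M U \<phi> V W \<and>
       subspace L \<and> L \<subseteq> W \<and> dim L = d \<and> \<phi> ` (U \<inter> S) = V \<inter> L)"


section \<open>Spherical tight frames and their Gram matrices\<close>

text \<open>The library's \<open>\<bullet>\<close> on complex vectors is only the real part of this product.\<close>

definition cinner :: "complex^'n \<Rightarrow> complex^'n \<Rightarrow> complex" where
  "cinner v w = (\<Sum>j\<in>UNIV. v $ j * cnj (w $ j))"

definition adjoint_matrix :: "complex^'n^'m \<Rightarrow> complex^'m^'n" where
  "adjoint_matrix A = (\<chi> i j. cnj (A $ j $ i))"

definition sphere_power :: "(('a::real_normed_vector)^'k) set" where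
  "sphere_power = {F. \<forall>i. F $ i \<in> sphere 0 1}"

definition spherical_tight_frames_real :: "((real^'n)^'k) set" where
  "spherical_tight_frames_real =
    {F \<in> sphere_power. \<exists>B>0. \<forall>v. (\<Sum>i\<in>UNIV. \<bar>v \<bullet> F $ i\<bar>\<^sup>2) = B * (norm v)\<^sup>2}"

definition spherical_tight_frames_complex :: "((complex^'n)^'k) set" where
  "spherical_tight_frames_complex =
    {F \<in> sphere_power. \<exists>B>0. \<forall>v. (\<Sum>i\<in>UNIV. (cmod (cinner v (F $ i)))\<^sup>2) = B * (norm v)\<^sup>2}"

definition gram_matrices_real :: "nat \<Rightarrow> (real^'k^'k) set" where
  "gram_matrices_real n =
    {(real CARD('k) / real n) *\<^sub>R P | P.
       transpose P = P \<and> P ** P = P \<and> rank P = n \<and> (\<forall>i. P $ i $ i = real n / real CARD('k))}"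

definition gram_matrices_complex :: "nat \<Rightarrow> (complex^'k^'k) set" where
  "gram_matrices_complex n =
    {(real CARD('k) / real n) *\<^sub>R P | P.
       adjoint_matrix P = P \<and> P ** P = P \<and> rank P = n \<and>
       (\<forall>i. P $ i $ i = of_nat n / of_nat CARD('k))}"

end

theory Submission
  imports Defs
begin

text \<open>
  All four sets are, near each of their points \<open>p\<close>, level sets of a map
  \<open>\<psi> (p + h) = \<psi> p + D h + Q h h\<close> that is quadratic in \<open>h\<close>, and the
  charts come from such maps alone.

  Suppose that \<open>\<psi> x - \<psi> p\<close> always lies in the range of \<open>D\<close>, and choose a
  linear \<open>s\<close> with \<open>D \<circ> s = id\<close> on that range. Then
  \<open>\<phi> x = (x - p) + s (Q (x - p) (x - p))\<close> satisfies
  \<open>D (\<phi> x) = \<psi> x - \<psi> p\<close>, so \<open>\<phi>\<close> carries every condition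
  \<open>\<psi> x - \<psi> p \<in> R\<close> to the linear condition \<open>D y \<in> R\<close>. Since \<open>\<phi>\<close> is a
  quadratic perturbation of a translation it is a local diffeomorphism, and its inverse is analytic:
  solving \<open>x = A z + B x x\<close> by Picard iteration produces a sequence of polynomials whose
  increments shrink geometrically in the norm \<open>\<Sum>\<^sub>\<alpha> norm (c \<alpha>) * r ^ deg \<alpha>\<close> of the
  coefficients (\<open>quadratic_fixpoint_series\<close>). Applied at every point of a neighbourhood this
  gives an analytic inverse on an open set without re-expanding power series
  (\<open>quadratic_local_inverse\<close>), and \<open>quadratic_slice_chart\<close> turns \<open>\<phi>\<close> into a slice chart
  of dimension \<open>dim (ker D)\<close>.

  It remains to find \<open>\<psi>\<close> and the orthogonal complement of the range of \<open>D\<close>, which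
  yields both the range condition and, by \<open>dim_kernel_dual\<close>, the dimension.
  The real and the complex case are treated together, over a field with a conjugation \<open>cj\<close>.
  A list of vectors is the matrix \<open>F\<close> with these rows, and it is tight iff
  \<open>F\<^sup>* F = c I\<close>, where unit rows force \<open>c = k / n\<close>.

  For frames \<open>\<psi> F\<close> consists of the squared norms of the rows and of \<open>F\<^sup>* F\<close>. A pair
  \<open>(a, H)\<close> orthogonal to the range of \<open>D\<close> makes \<open>diag a\<close> commute with the
  projection \<open>(1/c) F F\<^sup>*\<close>, whose diagonal entries are \<open>n / k\<close>. For Gram matrices
  \<open>\<psi> X\<close> consists of the skew part of \<open>X\<close>, of the two diagonal blocks of
  \<open>Y\<^sup>2 - Y\<close> with respect to the projection \<open>P\<close> at the base point, where \<open>Y\<close> is the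
  rescaled self-adjoint part of \<open>X\<close>, and of the diagonal of \<open>Y\<close> up to a constant vector;
  near \<open>P\<close> the vanishing of the diagonal blocks already forces \<open>Y\<^sup>2 = Y\<close>. Again the pairs
  orthogonal to the range involve a real diagonal matrix that commutes with \<open>P\<close>.

  Both times coprimality of \<open>n\<close> and \<open>k\<close> enters through \<open>commuting_diagonal_const\<close>: such a
  diagonal matrix is constant. Indeed a level set \<open>I\<close> of its entries cuts out a projection of
  trace \<open>card I * n / k\<close>; this is an integer, being the rank (\<open>trace_idempotent\<close>),
  so \<open>k\<close> divides \<open>card I\<close>.

  Finally the sets are not empty, because harmonic frames exist (\<open>harmonic_frame_exists\<close>).
\<close>


section \<open>Majorised power series\<close>

text \<open>
  The value at \<open>z\<close> of the monomial with exponent \<open>\<alpha>\<close>, in the coordinates with respect to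
  \<open>Basis\<close>.
\<close>

definition monom_val :: "('a::euclidean_space \<Rightarrow> nat) \<Rightarrow> 'a \<Rightarrow> real" where
  "monom_val \<alpha> z = (\<Prod>b\<in>Basis. (z \<bullet> b) ^ \<alpha> b)"

text \<open>
  The total degree of a multi-index.
\<close>

definition multi_deg :: "('a::euclidean_space \<Rightarrow> nat) \<Rightarrow> nat" where
  "multi_deg \<alpha> = (\<Sum>b\<in>Basis. \<alpha> b)"

text \<open>
  The multi-indices, normalised to be \<open>undefined\<close> outside \<open>Basis\<close>, so that each monomial has
  exactly one exponent.
\<close>

definition multi_idx :: "('a::euclidean_space \<Rightarrow> nat) set" where
  "multi_idx = (Basis \<rightarrow>\<^sub>E UNIV)"

text \<open>
  Sum of two multi-indices; \<open>\<lambda>b\<in>Basis\<close> restores the normalisation off \<open>Basis\<close>.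
\<close>

definition multi_add :: "('a::euclidean_space \<Rightarrow> nat) \<Rightarrow> ('a \<Rightarrow> nat) \<Rightarrow> 'a \<Rightarrow> nat" where
  "multi_add \<beta> \<gamma> = (\<lambda>b\<in>Basis. \<beta> b + \<gamma> b)"

text \<open>
  On the closed ball of radius \<open>r\<close> the map \<open>f\<close> is the sum of a power series whose
  coefficients satisfy \<open>\<Sum>\<^sub>\<alpha> norm (c \<alpha>) * r ^ multi_deg \<alpha> \<le> a\<close>. The bound \<open>a\<close> behaves like a
  Banach algebra norm: it is subadditive under (countable) sums and submultiplicative under bilinear
  maps.
\<close>

definition majorised_series ::
  "real \<Rightarrow> ('a::euclidean_space \<Rightarrow> 'b::euclidean_space) \<Rightarrow> real \<Rightarrow> bool" where
  "majorised_series r f a \<longleftrightarrow> (\<exists>c. (\<lambda>\<alpha>. norm (c \<alpha>) * r ^ multi_deg \<alpha>) summable_on multi_idx \<and>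
      infsum (\<lambda>\<alpha>. norm (c \<alpha>) * r ^ multi_deg \<alpha>) multi_idx \<le> a \<and>
      (\<forall>z. norm z \<le> r \<longrightarrow> ((\<lambda>\<alpha>. monom_val \<alpha> z *\<^sub>R c \<alpha>) has_sum f z) multi_idx))"

lemma multi_add_simps:
  "multi_add \<beta> \<gamma> \<in> multi_idx"
  "monom_val (multi_add \<beta> \<gamma>) z = monom_val \<beta> z * monom_val \<gamma> z"
  "multi_deg (multi_add \<beta> \<gamma>) = multi_deg \<beta> + multi_deg \<gamma>"
  by (auto simp: multi_add_def multi_idx_def monom_val_def multi_deg_def power_add prod.distrib sum.distrib)

lemma abs_monom_val_le: "\<bar>monom_val \<alpha> z\<bar> \<le> norm z ^ multi_deg \<alpha>"
proof -
  have "\<bar>monom_val \<alpha> z\<bar> = (\<Prod>b\<in>Basis. \<bar>z \<bullet> b\<bar> ^ \<alpha> b)"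
    by (simp add: monom_val_def abs_prod power_abs)
  also have "\<dots> \<le> (\<Prod>b\<in>Basis. norm z ^ \<alpha> b)"
    by (intro prod_mono) (auto intro!: power_mono Basis_le_norm)
  also have "\<dots> = norm z ^ multi_deg \<alpha>"
    by (simp add: multi_deg_def power_sum)
  finally show ?thesis .
qed

lemma nonneg_Sigma_summable:
  fixes h :: "'a \<times> 'b \<Rightarrow> real"
  assumes "\<And>x. h x \<ge> 0"
    and "\<And>x. x \<in> A \<Longrightarrow> (\<lambda>y. h (x, y)) summable_on B x"
    and "\<And>x. x \<in> A \<Longrightarrow> infsum (\<lambda>y. h (x, y)) (B x) \<le> n x"
    and "n summable_on A" "infsum n A \<le> a"
  shows "h summable_on Sigma A B" "infsum h (Sigma A B) \<le> a"
proof -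
  have s: "(\<lambda>x. infsum (\<lambda>y. h (x, y)) (B x)) summable_on A"
    by (rule summable_on_comparison_test[OF assms(4)]) (auto intro: assms infsum_nonneg)
  have [simp]: "\<bar>h p\<bar> = h p" for p
    using assms(1) by simp
  have [simp]: "\<bar>infsum (\<lambda>y. h (x, y)) (B x)\<bar> = infsum (\<lambda>y. h (x, y)) (B x)" for x
    using assms(1) by (simp add: infsum_nonneg)
  show 1: "h summable_on Sigma A B"
    using Infinite_Sum.abs_summable_on_Sigma_iff[of h A B] assms(2) s by simp
  have "infsum h (Sigma A B) = infsum (\<lambda>x. infsum (\<lambda>y. h (x, y)) (B x)) A"
    using infsum_Sigma_banach[OF 1] by simp
  also have "\<dots> \<le> infsum n A"
    by (rule infsum_mono) (use assms s in auto)
  finally show "infsum h (Sigma A B) \<le> a" using assms(5) by simp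
qed

text \<open>
  A sum of multiples of monomials over an arbitrary index set \<open>J\<close>, in which an exponent may occur
  many times, is a power series: terms with the same exponent are collected. Products and countable
  sums of power series are instances, with \<open>J\<close> the pairs of multi-indices, and the pairs of a number
  and a multi-index.
\<close>

lemma majorised_series_regroup:
  fixes f :: "'a::euclidean_space \<Rightarrow> 'b::euclidean_space" and J :: "'j set"
  assumes r: "r > 0" and d: "\<And>j. j \<in> J \<Longrightarrow> d j \<in> multi_idx"
    and summ: "(\<lambda>j. norm (e j) * r ^ multi_deg (d j)) summable_on J"
    and le: "infsum (\<lambda>j. norm (e j) * r ^ multi_deg (d j)) J \<le> a"
    and hs: "\<And>z. norm z \<le> r \<Longrightarrow> ((\<lambda>j. monom_val (d j) z *\<^sub>R e j) has_sum f z) J"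
  shows "majorised_series r f a"
proof -
  define fib where "fib \<alpha> = {j \<in> J. d j = \<alpha>}" for \<alpha>
  have bij: "bij_betw snd (Sigma multi_idx fib) J"
    by (rule bij_betwI[of _ _ _ "\<lambda>j. (d j, j)"]) (auto simp: fib_def d)
  have tr: "((\<lambda>p. g (fst p) (snd p)) has_sum s) (Sigma multi_idx fib) \<longleftrightarrow> ((\<lambda>j. g (d j) j) has_sum s) J"
    for g :: "('a \<Rightarrow> nat) \<Rightarrow> 'j \<Rightarrow> 'c::{comm_monoid_add,topological_space}" and s
  proof -
    have "((\<lambda>p. g (fst p) (snd p)) has_sum s) (Sigma multi_idx fib) \<longleftrightarrow>
        ((\<lambda>p. g (d (snd p)) (snd p)) has_sum s) (Sigma multi_idx fib)"
      by (rule has_sum_cong) (auto simp: fib_def)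
    then show ?thesis using has_sum_reindex_bij_betw[OF bij, of "\<lambda>j. g (d j) j"] by simp
  qed
  define c where "c \<alpha> = infsum e (fib \<alpha>)" for \<alpha>
  define n where "n \<alpha> = infsum (\<lambda>j. norm (e j) * r ^ multi_deg \<alpha>) (fib \<alpha>)" for \<alpha>
  let ?h = "\<lambda>p. norm (e (snd p)) * r ^ multi_deg (fst p)"
  have hS: "(?h has_sum infsum (\<lambda>j. norm (e j) * r ^ multi_deg (d j)) J) (Sigma multi_idx fib)"
    by (subst tr) (use summ in simp)
  have sumS: "?h summable_on Sigma multi_idx fib"
    using hS has_sum_imp_summable by blast
  have fibs: "(\<lambda>j. norm (e j) * r ^ multi_deg \<alpha>) summable_on fib \<alpha>" if "\<alpha> \<in> multi_idx" for \<alpha>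
    using summable_on_SigmaD1[of "\<lambda>\<alpha> j. norm (e j) * r ^ multi_deg \<alpha>" multi_idx fib \<alpha>] sumS that
    by (simp add: case_prod_unfold)
  have abs: "(\<lambda>j. norm (e j)) summable_on fib \<alpha>" if "\<alpha> \<in> multi_idx" for \<alpha>
    using fibs[OF that] summable_on_cmult_left'[of "r ^ multi_deg \<alpha>" "\<lambda>j. norm (e j)" "fib \<alpha>"] r by simp
  have hc: "(e has_sum c \<alpha>) (fib \<alpha>)" if "\<alpha> \<in> multi_idx" for \<alpha>
    unfolding c_def using abs_summable_summable[OF abs[OF that]] by simp
  have nle: "norm (c \<alpha>) * r ^ multi_deg \<alpha> \<le> n \<alpha>" if "\<alpha> \<in> multi_idx" for \<alpha>
    using norm_infsum_bound[OF abs[OF that]] r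
    by (simp add: n_def c_def infsum_cmult_left' mult_right_mono)
  have hn: "(n has_sum infsum (\<lambda>j. norm (e j) * r ^ multi_deg (d j)) J) multi_idx"
    by (rule has_sum_SigmaD[OF hS]) (use fibs in \<open>auto simp: n_def\<close>)
  have s1: "(\<lambda>\<alpha>. norm (c \<alpha>) * r ^ multi_deg \<alpha>) summable_on multi_idx"
    by (rule summable_on_comparison_test[OF has_sum_imp_summable[OF hn]]) (use nle r in auto)
  have s2: "infsum (\<lambda>\<alpha>. norm (c \<alpha>) * r ^ multi_deg \<alpha>) multi_idx \<le> a"
    using infsum_mono[OF s1 has_sum_imp_summable[OF hn] nle] le infsumI[OF hn] by simp
  have s3: "((\<lambda>\<alpha>. monom_val \<alpha> z *\<^sub>R c \<alpha>) has_sum f z) multi_idx" if "norm z \<le> r" for z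
  proof (rule has_sum_SigmaD)
    show "((\<lambda>p. monom_val (fst p) z *\<^sub>R e (snd p)) has_sum f z) (Sigma multi_idx fib)"
      by (subst tr[of "\<lambda>\<alpha> j. monom_val \<alpha> z *\<^sub>R e j"]) (use hs[OF that] in simp)
    show "((\<lambda>j. monom_val (fst (\<alpha>, j)) z *\<^sub>R e (snd (\<alpha>, j))) has_sum monom_val \<alpha> z *\<^sub>R c \<alpha>) (fib \<alpha>)"
      if "\<alpha> \<in> multi_idx" for \<alpha>
      using has_sum_bounded_linear[OF bounded_linear_scaleR_right hc[OF that]] by simp
  qed
  show ?thesis unfolding majorised_series_def using s1 s2 s3 by blast
qed

lemma majorised_series_nonneg: "majorised_series r f a \<Longrightarrow> r > 0 \<Longrightarrow> a \<ge> 0"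
  unfolding majorised_series_def by (meson infsum_nonneg mult_nonneg_nonneg norm_ge_zero order_trans
      zero_le_power less_imp_le)

lemma majorised_series_mono: "majorised_series r f a \<Longrightarrow> a \<le> b \<Longrightarrow> majorised_series r f b"
  unfolding majorised_series_def by (meson order_trans)

lemma majorised_series_norm_le:
  assumes "majorised_series r f a" "norm z \<le> r"
  shows "norm (f z) \<le> a"
proof -
  obtain c where c: "(\<lambda>\<alpha>. norm (c \<alpha>) * r ^ multi_deg \<alpha>) summable_on multi_idx"
    "infsum (\<lambda>\<alpha>. norm (c \<alpha>) * r ^ multi_deg \<alpha>) multi_idx \<le> a"
    "((\<lambda>\<alpha>. monom_val \<alpha> z *\<^sub>R c \<alpha>) has_sum f z) multi_idx"
    using assms unfolding majorised_series_def by blast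
  have le: "norm (monom_val \<alpha> z *\<^sub>R c \<alpha>) \<le> norm (c \<alpha>) * r ^ multi_deg \<alpha>" for \<alpha>
  proof -
    have "\<bar>monom_val \<alpha> z\<bar> \<le> r ^ multi_deg \<alpha>"
      using abs_monom_val_le[of \<alpha> z] power_mono[OF assms(2), of "multi_deg \<alpha>"] by simp
    then show ?thesis by (simp add: mult.commute mult_left_mono)
  qed
  have s: "(\<lambda>\<alpha>. norm (monom_val \<alpha> z *\<^sub>R c \<alpha>)) summable_on multi_idx"
    by (rule summable_on_comparison_test[OF c(1) le]) simp
  have "norm (f z) \<le> infsum (\<lambda>\<alpha>. norm (monom_val \<alpha> z *\<^sub>R c \<alpha>)) multi_idx"
    using norm_infsum_bound[OF s] infsumI[OF c(3)] by simp
  also have "\<dots> \<le> infsum (\<lambda>\<alpha>. norm (c \<alpha>) * r ^ multi_deg \<alpha>) multi_idx"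
    by (rule infsum_mono[OF s c(1) le])
  finally show ?thesis using c(2) by simp
qed

lemma majorised_series_const:
  assumes "r > 0" shows "majorised_series r (\<lambda>_. v) (norm v)"
  by (rule majorised_series_regroup[OF assms, where J="{()}" and d="\<lambda>_. \<lambda>b\<in>Basis. 0" and e="\<lambda>_. v"])
     (auto simp: multi_idx_def multi_deg_def monom_val_def intro!: has_sum_finiteI)

lemma majorised_series_linear:
  assumes "r > 0" "linear A" shows "majorised_series r A ((\<Sum>b\<in>Basis. norm (A b)) * r)"
proof (rule majorised_series_regroup[OF assms(1), where J=Basis and e=A and
      d="\<lambda>b. \<lambda>b'\<in>Basis. if b' = b then 1 else 0"])
  have [simp]: "multi_deg (\<lambda>b'\<in>Basis. if b' = b then 1 else 0) = 1" if "b \<in> Basis" for b :: 'a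
    using that by (simp add: multi_deg_def)
  have p [simp]: "monom_val (\<lambda>b'\<in>Basis. if b' = b then 1 else 0) z = z \<bullet> b" if "b \<in> Basis" for b z :: 'a
  proof -
    have "monom_val (\<lambda>b'\<in>Basis. if b' = b then 1 else 0) z = (\<Prod>b'\<in>Basis. if b' = b then z \<bullet> b' else 1)"
      unfolding monom_val_def by (intro prod.cong) auto
    then show ?thesis using that by simp
  qed
  show "(\<lambda>b'\<in>Basis. if b' = b then 1 else 0) \<in> multi_idx" for b :: 'a by (simp add: multi_idx_def)
  show "(\<lambda>j. norm (A j) * r ^ multi_deg (\<lambda>b'\<in>Basis. if b' = j then 1 else 0)) summable_on Basis"
    by simp
  show "infsum (\<lambda>j. norm (A j) * r ^ multi_deg (\<lambda>b'\<in>Basis. if b' = j then 1 else 0)) Basis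
      \<le> (\<Sum>b\<in>Basis. norm (A b)) * r"
    by (simp add: sum_distrib_right)
  show "((\<lambda>j. monom_val (\<lambda>b'\<in>Basis. if b' = j then 1 else 0) z *\<^sub>R A j) has_sum A z) Basis" for z
  proof (rule has_sum_finiteI)
    have "A z = A (\<Sum>b\<in>Basis. (z \<bullet> b) *\<^sub>R b)" by (simp add: euclidean_representation)
    then show "A z = (\<Sum>j\<in>Basis. monom_val (\<lambda>b'\<in>Basis. if b' = j then 1 else 0) z *\<^sub>R A j)"
      by (simp add: linear_sum[OF assms(2)] linear_scale[OF assms(2)])
  qed simp
qed

lemma majorised_series_add:
  assumes r: "r > 0" and "majorised_series r f a" "majorised_series r g b"
  shows "majorised_series r (\<lambda>z. f z + g z) (a + b)"
proof -
  obtain c where c: "(\<lambda>\<alpha>. norm (c \<alpha>) * r ^ multi_deg \<alpha>) summable_on multi_idx"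
    "infsum (\<lambda>\<alpha>. norm (c \<alpha>) * r ^ multi_deg \<alpha>) multi_idx \<le> a"
    "\<And>z. norm z \<le> r \<Longrightarrow> ((\<lambda>\<alpha>. monom_val \<alpha> z *\<^sub>R c \<alpha>) has_sum f z) multi_idx"
    using assms(2) unfolding majorised_series_def by blast
  obtain d where d: "(\<lambda>\<alpha>. norm (d \<alpha>) * r ^ multi_deg \<alpha>) summable_on multi_idx"
    "infsum (\<lambda>\<alpha>. norm (d \<alpha>) * r ^ multi_deg \<alpha>) multi_idx \<le> b"
    "\<And>z. norm z \<le> r \<Longrightarrow> ((\<lambda>\<alpha>. monom_val \<alpha> z *\<^sub>R d \<alpha>) has_sum g z) multi_idx"
    using assms(3) unfolding majorised_series_def by blast
  have le: "norm (c \<alpha> + d \<alpha>) * r ^ multi_deg \<alpha> \<le> norm (c \<alpha>) * r ^ multi_deg \<alpha> + norm (d \<alpha>) * r ^ multi_deg \<alpha>" for \<alpha>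
    using r by (simp add: mult_right_mono norm_triangle_ineq flip: distrib_right)
  have s: "(\<lambda>\<alpha>. norm (c \<alpha> + d \<alpha>) * r ^ multi_deg \<alpha>) summable_on multi_idx"
    by (rule summable_on_comparison_test[OF summable_on_add[OF c(1) d(1)] le]) (use r in simp)
  show ?thesis unfolding majorised_series_def
  proof (intro exI[of _ "\<lambda>\<alpha>. c \<alpha> + d \<alpha>"] conjI allI impI)
    show "infsum (\<lambda>\<alpha>. norm (c \<alpha> + d \<alpha>) * r ^ multi_deg \<alpha>) multi_idx \<le> a + b"
      using infsum_mono[OF s summable_on_add[OF c(1) d(1)] le] infsum_add[OF c(1) d(1)] c(2) d(2)
      by simp
    show "((\<lambda>\<alpha>. monom_val \<alpha> z *\<^sub>R (c \<alpha> + d \<alpha>)) has_sum f z + g z) multi_idx" if "norm z \<le> r" for z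
      using has_sum_add[OF c(3)[OF that] d(3)[OF that]] by (simp add: scaleR_add_right)
  qed (rule s)
qed

lemma majorised_series_bilinear:
  assumes r: "r > 0" and "majorised_series r f a" "majorised_series r g b"
    and B: "bounded_bilinear B" and K: "\<And>x y. norm (B x y) \<le> norm x * norm y * K" "K \<ge> 0"
  shows "majorised_series r (\<lambda>z. B (f z) (g z)) (K * a * b)"
proof -
  interpret B: bounded_bilinear B by (rule B)
  obtain c where c: "(\<lambda>\<alpha>. norm (c \<alpha>) * r ^ multi_deg \<alpha>) summable_on multi_idx"
    "infsum (\<lambda>\<alpha>. norm (c \<alpha>) * r ^ multi_deg \<alpha>) multi_idx \<le> a"
    "\<And>z. norm z \<le> r \<Longrightarrow> ((\<lambda>\<alpha>. monom_val \<alpha> z *\<^sub>R c \<alpha>) has_sum f z) multi_idx"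
    using assms(2) unfolding majorised_series_def by blast
  obtain d where d: "(\<lambda>\<alpha>. norm (d \<alpha>) * r ^ multi_deg \<alpha>) summable_on multi_idx"
    "infsum (\<lambda>\<alpha>. norm (d \<alpha>) * r ^ multi_deg \<alpha>) multi_idx \<le> b"
    "\<And>z. norm z \<le> r \<Longrightarrow> ((\<lambda>\<alpha>. monom_val \<alpha> z *\<^sub>R d \<alpha>) has_sum g z) multi_idx"
    using assms(3) unfolding majorised_series_def by blast
  have a: "a \<ge> 0" and b: "b \<ge> 0" using majorised_series_nonneg assms(2,3) r by blast+
  let ?e = "\<lambda>p. B (c (fst p)) (d (snd p))"
  let ?d = "\<lambda>p. multi_add (fst p) (snd p)"
  let ?h = "\<lambda>p. K * (norm (c (fst p)) * r ^ multi_deg (fst p)) * (norm (d (snd p)) * r ^ multi_deg (snd p))"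
  have hsum: "?h summable_on multi_idx \<times> multi_idx" "infsum ?h (multi_idx \<times> multi_idx) \<le> K * a * b"
  proof -
    let ?n = "\<lambda>\<alpha>. K * b * (norm (c \<alpha>) * r ^ multi_deg \<alpha>)"
    have 1: "?h p \<ge> 0" for p using r K by simp
    have 2: "(\<lambda>y. ?h (x, y)) summable_on multi_idx" for x
      using summable_on_cmult_right[OF d(1)] by simp
    have 3: "infsum (\<lambda>y. ?h (x, y)) multi_idx \<le> ?n x" for x
    proof -
      have "infsum (\<lambda>y. ?h (x, y)) multi_idx
          = (K * (norm (c x) * r ^ multi_deg x)) * infsum (\<lambda>\<alpha>. norm (d \<alpha>) * r ^ multi_deg \<alpha>) multi_idx"
        by (simp add: infsum_cmult_right')
      also have "\<dots> \<le> (K * (norm (c x) * r ^ multi_deg x)) * b"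
        using d(2) r K by (intro mult_left_mono) auto
      finally show ?thesis by (simp add: mult_ac)
    qed
    have 4: "?n summable_on multi_idx" using summable_on_cmult_right[OF c(1)] by simp
    have "infsum ?n multi_idx = (K * b) * infsum (\<lambda>\<alpha>. norm (c \<alpha>) * r ^ multi_deg \<alpha>) multi_idx"
      by (rule infsum_cmult_right')
    also have "\<dots> \<le> (K * b) * a" using c(2) K b by (intro mult_left_mono) auto
    finally have 5: "infsum ?n multi_idx \<le> K * a * b" by (simp add: mult_ac)
    show "?h summable_on multi_idx \<times> multi_idx" "infsum ?h (multi_idx \<times> multi_idx) \<le> K * a * b"
      using nonneg_Sigma_summable[of ?h multi_idx "\<lambda>_. multi_idx" ?n "K * a * b"] 1 2 3 4 5 by auto
  qed
  have le: "norm (?e p) * r ^ multi_deg (?d p) \<le> ?h p" for p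
  proof -
    have "norm (?e p) * r ^ multi_deg (?d p) \<le> (norm (c (fst p)) * norm (d (snd p)) * K) * r ^ multi_deg (?d p)"
      using K(1) r by (intro mult_right_mono) auto
    then show ?thesis by (simp add: multi_add_simps power_add mult_ac)
  qed
  have s: "(\<lambda>p. norm (?e p) * r ^ multi_deg (?d p)) summable_on multi_idx \<times> multi_idx"
    by (rule summable_on_comparison_test[OF hsum(1) le]) (use r in simp)
  show ?thesis
  proof (rule majorised_series_regroup[OF r, where J="multi_idx \<times> multi_idx" and d="?d" and e="?e"])
    show "infsum (\<lambda>p. norm (?e p) * r ^ multi_deg (?d p)) (multi_idx \<times> multi_idx) \<le> K * a * b"
      using infsum_mono[OF s hsum(1) le] hsum(2) by simp
    show "((\<lambda>j. monom_val (?d j) z *\<^sub>R ?e j) has_sum B (f z) (g z)) (multi_idx \<times> multi_idx)"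
      if z: "norm z \<le> r" for z
    proof (rule has_sum_SigmaI)
      show "((\<lambda>y. monom_val (?d (x, y)) z *\<^sub>R ?e (x, y)) has_sum B (monom_val x z *\<^sub>R c x) (g z)) multi_idx" for x
        using has_sum_bounded_linear[OF B.bounded_linear_right[of "monom_val x z *\<^sub>R c x"] d(3)[OF z]]
        by (simp add: multi_add_simps B.scaleR_left B.scaleR_right mult_ac)
      show "((\<lambda>x. B (monom_val x z *\<^sub>R c x) (g z)) has_sum B (f z) (g z)) multi_idx"
        by (rule has_sum_bounded_linear[OF B.bounded_linear_left c(3)[OF z]])
      have "(\<lambda>p. norm (monom_val (?d p) z *\<^sub>R ?e p)) summable_on multi_idx \<times> multi_idx"
      proof (rule summable_on_comparison_test[OF s])
        fix p :: "('a \<Rightarrow> nat) \<times> ('a \<Rightarrow> nat)"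
        have "\<bar>monom_val (?d p) z\<bar> \<le> r ^ multi_deg (?d p)"
          using abs_monom_val_le[of "?d p" z] power_mono[OF z, of "multi_deg (?d p)"] by simp
        then show "norm (monom_val (?d p) z *\<^sub>R ?e p) \<le> norm (?e p) * r ^ multi_deg (?d p)"
          by (simp add: mult.commute mult_right_mono)
      qed simp
      then show "(\<lambda>p. monom_val (?d p) z *\<^sub>R ?e p) summable_on (multi_idx \<times> multi_idx)"
        by (rule abs_summable_summable)
    qed
  qed (use s multi_add_simps in auto)
qed

lemma majorised_series_suminf:
  assumes r: "r > 0" and f: "\<And>N::nat. majorised_series r (f N) (a N)" and a: "summable a"
  shows "majorised_series r (\<lambda>z. \<Sum>N. f N z) (suminf a)"
proof -
  have "\<exists>c. \<forall>N. (\<lambda>\<alpha>. norm (c N \<alpha>) * r ^ multi_deg \<alpha>) summable_on multi_idx \<and>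
      infsum (\<lambda>\<alpha>. norm (c N \<alpha>) * r ^ multi_deg \<alpha>) multi_idx \<le> a N \<and>
      (\<forall>z. norm z \<le> r \<longrightarrow> ((\<lambda>\<alpha>. monom_val \<alpha> z *\<^sub>R c N \<alpha>) has_sum f N z) multi_idx)"
    using f unfolding majorised_series_def by (intro choice) blast
  then obtain c where c: "\<And>N. (\<lambda>\<alpha>. norm (c N \<alpha>) * r ^ multi_deg \<alpha>) summable_on multi_idx"
      "\<And>N. infsum (\<lambda>\<alpha>. norm (c N \<alpha>) * r ^ multi_deg \<alpha>) multi_idx \<le> a N"
      "\<And>N z. norm z \<le> r \<Longrightarrow> ((\<lambda>\<alpha>. monom_val \<alpha> z *\<^sub>R c N \<alpha>) has_sum f N z) multi_idx"
    by blast
  have a0: "a N \<ge> 0" for N using f r majorised_series_nonneg by blast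
  have asum: "(a has_sum suminf a) UNIV"
    by (rule norm_summable_imp_has_sum) (use a a0 in auto)
  let ?e = "\<lambda>p. c (fst p) (snd p)"
  let ?h = "\<lambda>p. norm (?e p) * r ^ multi_deg (snd p)"
  have hsum: "?h summable_on UNIV \<times> multi_idx" "infsum ?h (UNIV \<times> multi_idx) \<le> suminf a"
    using nonneg_Sigma_summable[of ?h UNIV "\<lambda>_. multi_idx" a "suminf a"] c asum r
    by (auto simp: has_sum_imp_summable infsumI)
  show ?thesis
  proof (rule majorised_series_regroup[OF r, where J="UNIV \<times> multi_idx" and d=snd and e="?e"])
    show "((\<lambda>j. monom_val (snd j) z *\<^sub>R ?e j) has_sum (\<Sum>N. f N z)) (UNIV \<times> multi_idx)"
      if z: "norm z \<le> r" for z
    proof (rule has_sum_SigmaI)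
      show "((\<lambda>y. monom_val (snd (N, y)) z *\<^sub>R ?e (N, y)) has_sum f N z) multi_idx" for N
        using c(3)[OF z] by simp
      have "summable (\<lambda>N. norm (f N z))"
        by (rule summable_comparison_test[OF _ a]) (use majorised_series_norm_le[OF f z] in auto)
      then show "((\<lambda>N. f N z) has_sum (\<Sum>N. f N z)) UNIV"
        by (intro norm_summable_imp_has_sum) (auto intro: summable_sums summable_norm_cancel)
      have "(\<lambda>p. norm (monom_val (snd p) z *\<^sub>R ?e p)) summable_on UNIV \<times> multi_idx"
      proof (rule summable_on_comparison_test[OF hsum(1)])
        fix p :: "nat \<times> ('a \<Rightarrow> nat)"
        have "\<bar>monom_val (snd p) z\<bar> \<le> r ^ multi_deg (snd p)"
          using abs_monom_val_le[of "snd p" z] power_mono[OF z, of "multi_deg (snd p)"] by simp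
        then show "norm (monom_val (snd p) z *\<^sub>R ?e p) \<le> ?h p"
          by (simp add: mult.commute mult_right_mono)
      qed simp
      then show "(\<lambda>p. monom_val (snd p) z *\<^sub>R ?e p) summable_on (UNIV \<times> multi_idx)"
        by (rule abs_summable_summable)
    qed
  qed (use hsum in auto)
qed

lemma majorised_series_imp_real_analytic_at:
  assumes r: "r > 0" and "majorised_series r (\<lambda>z. f (x + z)) a"
  shows "real_analytic_at f x"
proof -
  obtain c where c: "\<And>z. norm z \<le> r \<Longrightarrow> ((\<lambda>\<alpha>. monom_val \<alpha> z *\<^sub>R c \<alpha>) has_sum f (x + z)) multi_idx"
    using assms(2) unfolding majorised_series_def by blast
  have "\<forall>\<^sub>F y in nhds x. dist y x < r"
    unfolding eventually_nhds_metric using r by blast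
  then show ?thesis
    unfolding real_analytic_at_def
  proof (intro exI[of _ c], eventually_elim)
    case (elim y)
    then show ?case using c[of "y - x"] by (simp add: dist_norm monom_val_def multi_idx_def)
  qed
qed

text \<open>
  The solution of \<open>x = A z + B x x\<close> that vanishes at \<open>z = 0\<close> is a convergent power series
  in \<open>z\<close>, with values as small as desired.
\<close>

lemma quadratic_fixpoint_series:
  fixes A :: "'a::euclidean_space \<Rightarrow> 'b::euclidean_space"
  assumes A: "linear A" and B: "bounded_bilinear B" and eps: "\<epsilon> > 0"
  shows "\<exists>r>0. \<exists>g a. majorised_series r g a \<and>
    (\<forall>z. norm z \<le> r \<longrightarrow> norm (g z) \<le> \<epsilon> \<and> g z = A z + B (g z) (g z))"
proof -
  interpret B: bounded_bilinear B by (rule B)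
  obtain K where K: "K > 0" "\<And>x y. norm (B x y) \<le> norm x * norm y * K"
    using B.pos_bounded by blast
  define M where "M = (\<Sum>b\<in>Basis. norm (A b))"
  have M: "M \<ge> 0" by (simp add: M_def sum_nonneg)
  \<comment> \<open>With \<open>K * \<rho> \<le> 1/4\<close>, the step \<open>g \<mapsto> A + B g g\<close> preserves the bound \<open>\<rho>\<close> and is a contraction with factor \<open>1/2\<close>.\<close>
  define \<rho> where "\<rho> = min \<epsilon> (1 / (4 * K))"
  have \<rho>: "\<rho> > 0" "\<rho> \<le> \<epsilon>" "K * \<rho> \<le> 1/4"
    using eps K by (auto simp: \<rho>_def min_def field_simps)
  define r where "r = \<rho> / (2 * (M + 1))"
  have r: "r > 0" using \<rho> M by (simp add: r_def)
  have "M * r \<le> \<rho> / 2" using \<rho> M by (simp add: r_def field_simps)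
  then have PA: "majorised_series r A (\<rho>/2)"
    using majorised_series_mono[OF majorised_series_linear[OF r A]] by (simp add: M_def)
  define G where "G = rec_nat (\<lambda>z. 0) (\<lambda>_ g z. A z + B (g z) (g z))"
  have G0: "G 0 = (\<lambda>z. 0)" and GS: "G (Suc N) = (\<lambda>z. A z + B (G N z) (G N z))" for N
    by (simp_all add: G_def)
  have PG: "majorised_series r (G N) \<rho>" for N
  proof (induction N)
    case 0
    then show ?case using majorised_series_mono[OF majorised_series_const[OF r, of 0], of \<rho>] \<rho> by (simp add: G0)
  next
    case (Suc N)
    have "majorised_series r (G (Suc N)) (\<rho>/2 + K * \<rho> * \<rho>)"
      unfolding GS using majorised_series_add[OF r PA majorised_series_bilinear[OF r Suc Suc B K(2)]] K by simp
    moreover have "K * \<rho> * \<rho> \<le> 1/4 * \<rho>" using \<rho> by (intro mult_right_mono) auto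
    ultimately show ?case using \<rho> by (elim majorised_series_mono) linarith
  qed
  define d where "d N z = G (Suc N) z - G N z" for N z
  have Pd: "majorised_series r (d N) (\<rho>/2 * (1/2)^N)" for N
  proof (induction N)
    case 0
    have "d 0 = A" by (auto simp: d_def GS G0 B.zero_left)
    then show ?case using PA by simp
  next
    case (Suc N)
    \<comment> \<open>\<open>B g' g' - B g g = B g' (g' - g) + B (g' - g) g\<close>\<close>
    have eq: "d (Suc N) = (\<lambda>z. B (G (Suc N) z) (d N z) + B (d N z) (G N z))"
      unfolding d_def GS[of "Suc N"] by (auto simp: GS[of N] B.diff_left B.diff_right algebra_simps)
    have "majorised_series r (d (Suc N)) (K * \<rho> * (\<rho>/2 * (1/2)^N) + K * (\<rho>/2 * (1/2)^N) * \<rho>)"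
      unfolding eq using majorised_series_add[OF r majorised_series_bilinear[OF r PG Suc B K(2)] majorised_series_bilinear[OF r Suc PG B K(2)]] K
      by simp
    moreover have "K * \<rho> * (\<rho>/2 * (1/2)^N) \<le> 1/4 * (\<rho>/2 * (1/2)^N)"
      using \<rho> by (intro mult_right_mono) auto
    ultimately show ?case by (elim majorised_series_mono) (simp add: mult_ac)
  qed
  define g where "g z = (\<Sum>N. d N z)" for z
  have sm: "(\<lambda>N. \<rho>/2 * (1/2)^N) sums \<rho>"
    using sums_mult[OF geometric_sums[of "1/2::real"], of "\<rho>/2"] by simp
  have Pg: "majorised_series r g \<rho>"
    using majorised_series_suminf[OF r Pd sums_summable[OF sm]] sums_unique[OF sm] by (simp add: g_def[abs_def])
  have "g z = A z + B (g z) (g z)" if z: "norm z \<le> r" for z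
  proof -
    have "summable (\<lambda>N. d N z)"
      by (rule summable_comparison_test[OF _ sums_summable[OF sm]]) (use majorised_series_norm_le[OF Pd z] in auto)
    then have "(\<lambda>n. \<Sum>N<n. d N z) \<longlonglongrightarrow> g z"
      unfolding g_def by (rule summable_LIMSEQ)
    moreover have "(\<Sum>N<n. d N z) = G n z" for n
      using sum_lessThan_telescope[of "\<lambda>N. G N z" n] by (simp add: d_def G0)
    ultimately have lim: "(\<lambda>n. G n z) \<longlonglongrightarrow> g z" by simp
    have "(\<lambda>n. G (Suc n) z) \<longlonglongrightarrow> A z + B (g z) (g z)"
      unfolding GS by (intro tendsto_intros B.tendsto lim)
    then show ?thesis using LIMSEQ_Suc[OF lim] LIMSEQ_unique by blast
  qed
  then show ?thesis using r Pg majorised_series_norm_le[OF Pg] \<rho>(2) by (meson order_trans)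
qed

section \<open>Quadratic maps and their local inverses\<close>

lemma real_analytic_at_quadratic:
  assumes f: "\<And>h. f (x + h) = v + A h + B h h" and A: "linear A" and B: "bounded_bilinear B"
  shows "real_analytic_at f x"
proof -
  obtain K where K: "K > 0" "\<And>x y. norm (B x y) \<le> norm x * norm y * K"
    using bounded_bilinear.pos_bounded[OF B] by blast
  have 1: "majorised_series 1 (\<lambda>h::'a. h) (real DIM('a))"
    using majorised_series_linear[of 1 "\<lambda>h::'a. h"] by (simp add: linear_id[unfolded id_def])
  have "majorised_series 1 (\<lambda>h. v + A h + B h h)
      (norm v + (\<Sum>b\<in>Basis. norm (A b)) * 1 + K * real DIM('a) * real DIM('a))"
    using K by (intro majorised_series_add majorised_series_const majorised_series_linear A majorised_series_bilinear[OF _ 1 1 B]) auto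
  then show ?thesis
    using majorised_series_imp_real_analytic_at[of 1 f x] by (simp add: f)
qed

lemma bounded_bilinear_linear_comp:
  fixes Q :: "'a::euclidean_space \<Rightarrow> 'b::euclidean_space \<Rightarrow> 'c::euclidean_space"
    and s :: "'c \<Rightarrow> 'd::euclidean_space"
  assumes "linear s" "bounded_bilinear Q"
  shows "bounded_bilinear (\<lambda>x y. s (Q x y))"
proof -
  interpret s: linear s by fact
  interpret Q: bounded_bilinear Q by fact
  show ?thesis
    unfolding bilinear_conv_bounded_bilinear[symmetric] bilinear_def
    by (auto intro!: linearI simp: Q.add_left Q.add_right Q.scaleR_left Q.scaleR_right s.add s.scale)
qed

text \<open>
  A quadratic map is quadratic around every point, with the same bilinear part.
\<close>

lemma quadratic_shift:
  fixes B :: "'a::real_normed_vector \<Rightarrow> 'a \<Rightarrow> 'a" and p :: 'a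
  assumes "bounded_bilinear B"
  defines "\<phi> \<equiv> \<lambda>x. (x - p) + B (x - p) (x - p)"
  shows "\<phi> (x + h) = \<phi> x + (h + B (x - p) h + B h (x - p)) + B h h"
proof -
  interpret B: bounded_bilinear B by fact
  define u where "u = x - p"
  have eq: "x + h - p = u + h" by (simp add: u_def)
  have "\<phi> (x + h) = (u + h) + B (u + h) (u + h)" by (simp only: \<phi>_def eq)
  also have "\<dots> = (u + B u u) + (h + B u h + B h u) + B h h"
    by (simp add: B.add_left B.add_right)
  finally show ?thesis by (simp add: \<phi>_def u_def)
qed

text \<open>
  A quadratic map with derivative \<open>id\<close> at \<open>p\<close> is injective and open near \<open>p\<close>, and its
  inverse is analytic at every point of the image: by \<open>quadratic_shift\<close> the equation to be solved at
  an arbitrary point \<open>x\<close> has the form treated in \<open>quadratic_fixpoint_series\<close>.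
\<close>

lemma quadratic_local_inverse:
  fixes B :: "'a::euclidean_space \<Rightarrow> 'a \<Rightarrow> 'a" and p :: 'a
  assumes B: "bounded_bilinear B" and N: "open N" "p \<in> N"
  defines "\<phi> \<equiv> \<lambda>x. (x - p) + B (x - p) (x - p)"
  obtains U where "open U" "p \<in> U" "U \<subseteq> N" "inj_on \<phi> U" "open (\<phi> ` U)"
    "\<And>y. y \<in> \<phi> ` U \<Longrightarrow> real_analytic_at (inv_into U \<phi>) y"
proof -
  interpret B: bounded_bilinear B by (rule B)
  obtain K where K: "K > 0" "\<And>x y. norm (B x y) \<le> norm x * norm y * K"
    using B.pos_bounded by blast
  obtain e where e: "e > 0" "ball p e \<subseteq> N"
    using N open_contains_ball by blast
  define \<rho> where "\<rho> = min e (1 / (4 * K))"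
  have \<rho>: "\<rho> > 0" "\<rho> \<le> e" "K * \<rho> \<le> 1/4"
    using e K by (auto simp: \<rho>_def min_def field_simps)
  define U where "U = ball p \<rho>"
  have U: "open U" "p \<in> U" "U \<subseteq> N"
    using \<rho> e by (auto simp: U_def)
  have Usmall: "norm (x - p) < \<rho>" if "x \<in> U" for x
    using that by (simp add: U_def dist_norm norm_minus_commute)
  have small: "norm (B (x - p) h) \<le> norm h / 4" "norm (B h (x - p)) \<le> norm h / 4"
    if "x \<in> U" for x h
  proof -
    have 1: "norm (x - p) * K \<le> 1/4"
      using Usmall[OF that] K(1) \<rho>(3) by (smt (verit) mult.commute mult_left_mono)
    then have 2: "norm (x - p) * K * norm h \<le> 1/4 * norm h" by (intro mult_right_mono) auto
    show "norm (B (x - p) h) \<le> norm h / 4" "norm (B h (x - p)) \<le> norm h / 4"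
      using K(2)[of "x - p" h] K(2)[of h "x - p"] 2 by (simp_all add: mult_ac)
  qed
  have expand: "\<phi> (x + h) = \<phi> x + (h + B (x - p) h + B h (x - p)) + B h h" for x h
    unfolding \<phi>_def by (rule quadratic_shift[OF B])
  have inj: "inj_on \<phi> U"
  proof (rule inj_onI)
    fix x x' assume x: "x \<in> U" "x' \<in> U" "\<phi> x = \<phi> x'"
    define h where "h = x' - x"
    have "h + B (x - p) h + B h (x - p) + B h h = 0"
      using expand[of x h] x(3) by (simp add: h_def)
    moreover have "B h (x' - p) = B h (x - p) + B h h"
      by (simp add: h_def flip: B.add_right)
    ultimately have "h + (B (x - p) h + B h (x' - p)) = 0"
      by (simp only: add.assoc)
    then have "norm h = norm (B (x - p) h + B h (x' - p))"
      by (metis eq_neg_iff_add_eq_0 norm_minus_cancel)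
    then have "norm h \<le> norm (B (x - p) h) + norm (B h (x' - p))"
      by (simp add: norm_triangle_ineq)
    also have "\<dots> \<le> norm h / 2" using small(1)[OF x(1), of h] small(2)[OF x(2), of h] by simp
    finally have "h = 0" by simp
    then show "x = x'" by (simp add: h_def)
  qed
  have cont: "continuous_on U \<phi>"
    unfolding \<phi>_def by (intro continuous_intros B.continuous_on)
  have opn: "open (\<phi> ` U)"
    by (rule invariance_of_domain[OF cont U(1) inj])
  have "real_analytic_at (inv_into U \<phi>) y" if y: "y \<in> \<phi> ` U" for y
  proof -
    obtain x where x: "x \<in> U" "y = \<phi> x" using y by blast
    define A where "A h = h + B (x - p) h + B h (x - p)" for h
    have linA: "linear A"
      by (rule linearI) (simp_all add: A_def B.add_left B.add_right B.scaleR_left B.scaleR_right algebra_simps)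
    have "inj A"
      unfolding linear_injective_0[OF linA]
    proof (intro allI impI)
      fix h assume "A h = 0"
      then have "norm h = norm (B (x - p) h + B h (x - p))"
        by (metis A_def add.assoc eq_neg_iff_add_eq_0 norm_minus_cancel)
      then have "norm h \<le> norm (B (x - p) h) + norm (B h (x - p))"
        by (simp add: norm_triangle_ineq)
      also have "\<dots> \<le> norm h / 2" using small[OF x(1), of h] by simp
      finally show "h = 0" by simp
    qed
    then obtain A' where A': "linear A'" "\<And>h. A (A' h) = h"
      using linear_injective_isomorphism[OF linA] by blast
    interpret A': linear A' by (rule A'(1))
    have bB: "bounded_bilinear (\<lambda>u v. A' (- B u v))"
      by (rule bounded_bilinear_linear_comp[OF _ B, where s="\<lambda>w. A' (- w)"])
         (auto intro!: linearI simp: A'.add A'.scale A'.neg A'.diff)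
    \<comment> \<open>Values of the series below \<open>\<epsilon>\<close> keep \<open>x + g z\<close> inside \<open>U\<close>, where \<open>\<phi>\<close> is injective.\<close>
    define \<epsilon> where "\<epsilon> = (\<rho> - norm (x - p)) / 2"
    have \<epsilon>: "\<epsilon> > 0" using Usmall[OF x(1)] by (simp add: \<epsilon>_def)
    obtain r g a where r: "r > 0" and g: "majorised_series r g a"
      "\<And>z. norm z \<le> r \<Longrightarrow> norm (g z) \<le> \<epsilon> \<and> g z = A' z + A' (- B (g z) (g z))"
      using quadratic_fixpoint_series[OF A'(1) bB \<epsilon>] by blast
    have inv: "inv_into U \<phi> (y + z) = x + g z" if z: "norm z \<le> r" for z
    proof -
      have "norm (x + g z - p) \<le> norm (x - p) + norm (g z)"
        by (metis add_diff_eq diff_add_eq norm_triangle_ineq)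
      also have "\<dots> < \<rho>" using g(2)[OF z] Usmall[OF x(1)] by (simp add: \<epsilon>_def field_simps)
      finally have in_U: "x + g z \<in> U"
        by (simp add: U_def dist_norm norm_minus_commute)
      have "A (g z) = A (A' (z - B (g z) (g z)))"
        using g(2)[OF z] by (metis A'.add diff_conv_add_uminus)
      then have "A (g z) + B (g z) (g z) = z" by (simp add: A'(2))
      then have "\<phi> (x + g z) = y + z"
        using expand[of x "g z"] by (simp add: A_def x(2) add_ac)
      then show ?thesis using inv_into_f_f[OF inj in_U] by simp
    qed
    have "majorised_series r (\<lambda>z. x + g z) (norm x + a)"
      by (intro majorised_series_add majorised_series_const r g(1))
    then have "majorised_series r (\<lambda>z. inv_into U \<phi> (y + z)) (norm x + a)"
      unfolding majorised_series_def by (simp add: inv)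
    then show ?thesis by (rule majorised_series_imp_real_analytic_at[OF r])
  qed
  then show ?thesis using that[OF U inj opn] by blast
qed


section \<open>Slice charts for level sets of quadratic maps\<close>

lemma real_analytic_map_onI:
  assumes "\<And>x. x \<in> A \<Longrightarrow> \<exists>U. open U \<and> x \<in> U \<and> (\<forall>y\<in>U. real_analytic_at g y)"
    and "\<And>x. x \<in> A \<Longrightarrow> f x = g x"
  shows "real_analytic_map_on f A"
  unfolding real_analytic_map_on_def using assms by (metis IntE)

lemma mem_range_if_orthogonal:
  fixes D :: "'a::euclidean_space \<Rightarrow> 'b::euclidean_space"
  assumes D: "linear D" and w: "\<And>y. (\<And>h. y \<bullet> D h = 0) \<Longrightarrow> y \<bullet> w = 0"
  shows "w \<in> range D"
proof -
  have s: "subspace (range D)" by (rule linear_subspace_image[OF D subspace_UNIV])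
  have "w \<in> (range D)\<^sup>\<bottom>\<^sup>\<bottom>"
    using w by (auto simp: orthogonal_comp_def orthogonal_def inner_commute)
  then show ?thesis by (simp add: orthogonal_comp_self[OF s])
qed

text \<open>
  Rank and nullity, with the rank expressed by the orthogonal complement of the range.
\<close>

lemma dim_kernel_dual:
  fixes D :: "'a::euclidean_space \<Rightarrow> 'b::euclidean_space"
  assumes D: "linear D"
  shows "dim {h. D h = 0} + DIM('b) = DIM('a) + dim {y. \<forall>h. y \<bullet> D h = 0}"
proof -
  interpret D: linear D by fact
  define K where "K = {h. D h = 0}"
  have sK: "subspace K" unfolding K_def by (rule linear_subspace_kernel[OF D])
  define V where "V = {y \<in> UNIV. \<forall>x\<in>K. orthogonal x y}"
  have sV: "subspace V" unfolding V_def
    by (auto simp: subspace_def orthogonal_def inner_add_right)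
  have dV: "dim V + dim K = DIM('a)"
    using dim_subspace_orthogonal_to_vectors[OF sK subspace_UNIV] by (simp add: V_def)
  have injV: "inj_on D (span V)"
  proof (rule inj_onI)
    fix x y assume "x \<in> span V" "y \<in> span V" "D x = D y"
    then have "x - y \<in> V" "x - y \<in> K"
      using sV by (auto simp: K_def D.diff span_eq_iff[THEN iffD2] subspace_diff)
    then show "x = y" by (auto simp: V_def orthogonal_def)
  qed
  have "range D \<subseteq> D ` V"
  proof clarify
    fix h
    obtain u v where uv: "h = u + v" "u \<in> span K" "\<And>w. w \<in> span K \<Longrightarrow> orthogonal v w"
      using orthogonal_subspace_decomp_exists[of K h] by metis
    have "v \<in> V" using uv(3) by (auto simp: V_def span_base orthogonal_commute)
    moreover have "D h = D v" using uv(1,2) sK by (simp add: D.add K_def span_eq_iff[THEN iffD2])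
    ultimately show "D h \<in> D ` V" by blast
  qed
  then have "range D = D ` V" by blast
  then have dR: "dim (range D) = dim V" using dim_image_eq[OF D injV] by simp
  have "dim {y \<in> UNIV. \<forall>x\<in>range D. orthogonal x y} + dim (range D) = DIM('b)"
    using dim_subspace_orthogonal_to_vectors[OF linear_subspace_image[OF D subspace_UNIV] subspace_UNIV]
    by simp
  moreover have "{y \<in> UNIV. \<forall>x\<in>range D. orthogonal x y} = {y. \<forall>h. y \<bullet> D h = 0}"
    by (auto simp: orthogonal_def inner_commute)
  ultimately show ?thesis using dV dR by (simp add: K_def)
qed

text \<open>
  Near \<open>p\<close>, let \<open>M\<close> be given by \<open>\<psi> x - \<psi> p \<in> R\<close>, and \<open>S\<close> by
  \<open>\<psi> x = \<psi> p\<close>, where \<open>\<psi>\<close> is quadratic and \<open>\<psi> x - \<psi> p\<close> lies in the range of its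
  derivative \<open>D\<close> at \<open>p\<close> (assumption \<open>rng\<close>, in dual form). Then \<open>S\<close> has a slice chart in
  \<open>M\<close> at \<open>p\<close>, with model spaces \<open>{h. D h \<in> R}\<close> and \<open>{h. D h = 0}\<close>.
\<close>

lemma quadratic_slice_chart:
  fixes \<psi> :: "'a::euclidean_space \<Rightarrow> 'b::euclidean_space"
  assumes \<psi>: "\<And>h. \<psi> (p + h) = \<psi> p + D h + Q h h"
    and D: "linear D" and Q: "bounded_bilinear Q"
    and rng: "\<And>x y. (\<And>h. y \<bullet> D h = 0) \<Longrightarrow> y \<bullet> (\<psi> x - \<psi> p) = 0"
    and R: "subspace R" and N: "open N" "p \<in> N"
    and M: "\<And>x. x \<in> N \<Longrightarrow> x \<in> M \<longleftrightarrow> \<psi> x - \<psi> p \<in> R"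
    and S: "\<And>x. x \<in> N \<Longrightarrow> x \<in> S \<longleftrightarrow> \<psi> x = \<psi> p"
  shows "\<exists>U \<phi> V W L. p \<in> U \<and> analytic_chart M U \<phi> V W \<and>
       subspace L \<and> L \<subseteq> W \<and> dim L = dim {h. D h = 0} \<and> \<phi> ` (U \<inter> S) = V \<inter> L"
proof -
  interpret D: linear D by fact
  interpret Q: bounded_bilinear Q by fact
  have "\<exists>g. range g \<subseteq> UNIV \<and> linear g \<and> (\<forall>v\<in>range D. D (g v) = v)"
    by (rule linear_exists_right_inverse_on[OF D subspace_UNIV])
  then obtain s where s: "linear s" "\<And>v. v \<in> range D \<Longrightarrow> D (s v) = v"
    by auto
  define B where "B u v = s (Q u v)" for u v
  have B: "bounded_bilinear B"
    unfolding B_def by (rule bounded_bilinear_linear_comp[OF s(1) Q])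
  define \<phi> where "\<phi> x = (x - p) + B (x - p) (x - p)" for x
  \<comment> \<open>The point of the construction: \<open>D\<close> turns \<open>\<phi>\<close> back into \<open>\<psi>\<close>, because \<open>D (s (Q u u)) = Q u u\<close>.\<close>
  have D\<phi>: "D (\<phi> x) = \<psi> x - \<psi> p" for x
  proof -
    have "\<psi> x - \<psi> p = D (x - p) + Q (x - p) (x - p)" using \<psi>[of "x - p"] by simp
    moreover have "\<psi> x - \<psi> p \<in> range D"
      using mem_range_if_orthogonal[OF D, of "\<psi> x - \<psi> p"] rng by blast
    then obtain w where "\<psi> x - \<psi> p = D w" by blast
    then have "(\<psi> x - \<psi> p) - D (x - p) = D (w - (x - p))" by (simp add: D.diff)
    then have "(\<psi> x - \<psi> p) - D (x - p) \<in> range D" by blast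
    ultimately have "Q (x - p) (x - p) \<in> range D" by simp
    then show ?thesis using \<psi>[of "x - p"] by (simp add: \<phi>_def B_def D.add s(2))
  qed
  obtain U where U: "open U" "p \<in> U" "U \<subseteq> N" "inj_on \<phi> U" "open (\<phi> ` U)"
    "\<And>y. y \<in> \<phi> ` U \<Longrightarrow> real_analytic_at (inv_into U \<phi>) y"
    using quadratic_local_inverse[OF B N] unfolding \<phi>_def[symmetric] by metis
  define W where "W = {h. D h \<in> R}"
  define L where "L = {h. D h = 0}"
  have sW: "subspace W" unfolding W_def
    using linear_subspace_vimage[OF D R] by (simp add: vimage_def)
  have sL: "subspace L" unfolding L_def by (rule linear_subspace_kernel[OF D])
  have LW: "L \<subseteq> W" using subspace_0[OF R] by (auto simp: L_def W_def)
  have M': "x \<in> M \<longleftrightarrow> \<phi> x \<in> W" if "x \<in> U" for x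
    using M[of x] that U(3) D\<phi> by (auto simp: W_def)
  have S': "x \<in> S \<longleftrightarrow> \<phi> x \<in> L" if "x \<in> U" for x
    using S[of x] that U(3) D\<phi> by (auto simp: L_def)
  have pM: "p \<in> M" using M[OF N(2)] subspace_0[OF R] by simp
  define V where "V = \<phi> ` U \<inter> W"
  have bij: "bij_betw \<phi> (U \<inter> M) V"
    using U(4) M' by (auto simp: bij_betw_def V_def inj_on_def)
  have inv: "inv_into (U \<inter> M) \<phi> y = inv_into U \<phi> y" if y: "y \<in> V" for y
  proof -
    obtain x where x: "x \<in> U \<inter> M" "y = \<phi> x" using y bij unfolding bij_betw_def by blast
    then show ?thesis
      using inv_into_f_f[OF U(4), of x] inv_into_f_f[OF bij_betw_imp_inj_on[OF bij], of x] by simp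
  qed
  have an: "real_analytic_at \<phi> x" for x
  proof (rule real_analytic_at_quadratic[of \<phi> x _ "\<lambda>h. h + B (x - p) h + B h (x - p)" B])
    interpret B: bounded_bilinear B by (rule B)
    show "\<phi> (x + h) = \<phi> x + (h + B (x - p) h + B h (x - p)) + B h h" for h
      unfolding \<phi>_def by (rule quadratic_shift[OF B])
    show "linear (\<lambda>h. h + B (x - p) h + B h (x - p))"
      by (rule linearI) (simp_all add: B.add_left B.add_right B.scaleR_left B.scaleR_right algebra_simps)
  qed (rule B)
  have "analytic_diffeo \<phi> (U \<inter> M) V"
    unfolding analytic_diffeo_def
  proof (intro conjI bij)
    show "real_analytic_map_on \<phi> (U \<inter> M)"
      by (rule real_analytic_map_onI[of _ \<phi>]) (use an in auto)
    show "real_analytic_map_on (inv_into (U \<inter> M) \<phi>) V"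
      by (rule real_analytic_map_onI[of _ "inv_into U \<phi>"])
         (use U inv in \<open>auto simp: V_def\<close>)
  qed
  then have "analytic_chart M (U \<inter> M) \<phi> V W"
    unfolding analytic_chart_def using U(1,5) sW by (auto simp: V_def openin_open)
  moreover have "\<phi> ` ((U \<inter> M) \<inter> S) = V \<inter> L"
    using M' S' LW by (auto simp: V_def)
  ultimately show ?thesis using U(2) pM sL LW unfolding L_def by blast
qed

lemma regular_analytic_submanifoldI:
  assumes "S \<noteq> {}" "S \<subseteq> M"
    and "\<And>p. p \<in> S \<Longrightarrow> \<exists>U \<phi> V W L. p \<in> U \<and> analytic_chart M U \<phi> V W \<and>
       subspace L \<and> L \<subseteq> W \<and> real (dim L) = v \<and> \<phi> ` (U \<inter> S) = V \<inter> L"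
  shows "\<exists>d. real d = v \<and> regular_analytic_submanifold d S M"
proof -
  obtain p where "p \<in> S" using assms(1) by blast
  then obtain d where d: "real d = v" using assms(3) by blast
  have "dim L = d" if "real (dim L) = v" for L :: "'a set" using that d by simp
  then have "regular_analytic_submanifold d S M"
    unfolding regular_analytic_submanifold_def using assms by metis
  then show ?thesis using d by blast
qed


section \<open>Ranks, traces and dimensions\<close>

text \<open>
  Each vector of a basis \<open>B\<close> consisting of columns of \<open>P\<close> is fixed by \<open>P\<close>. Writing the columns
  of \<open>P\<close> in this basis, the trace becomes the sum over \<open>b \<in> B\<close> of the \<open>b\<close>-coordinate of
  \<open>P b = b\<close>.
\<close>

lemma trace_idempotent_columns:
  fixes P :: "'a::field^'n^'n"
  assumes P: "P ** P = P"
  shows "trace P = of_nat (vec.dim (columns P))"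
proof -
  obtain B where B: "B \<subseteq> columns P" "vec.independent B" "columns P \<subseteq> vec.span B"
      "card B = vec.dim (columns P)"
    using vec.basis_exists by blast
  have fin: "finite B" using B(2) vec.finiteI_independent by blast
  define r where "r v b = vec.representation B v b" for v b
  have col: "column i P \<in> columns P" for i by (auto simp: columns_def)
  have exp: "(\<Sum>b\<in>B. r (column i P) b *s b) = column i P" for i
    unfolding r_def using B(3) col[of i]
    by (intro vec.sum_representation_eq[OF B(2) _ fin]) auto
  have fix_b: "P *v b = b" if b: "b \<in> B" for b
  proof -
    have colmul: "column i P = P *v axis i 1" for i
      by (simp add: vec_eq_iff column_def matrix_vector_mult_def axis_def if_distrib[of "\<lambda>x. y * x" for y] cong: if_cong)
    obtain i where "b = column i P" using b B(1) unfolding columns_def by blast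
    then show ?thesis by (simp add: colmul matrix_vector_mul_assoc P)
  qed
  have one: "(\<Sum>i\<in>UNIV. r (column i P) b * b $ i) = 1" if b: "b \<in> B" for b
  proof -
    have span: "b $ i *s column i P \<in> vec.span B" for i
      using B(3) col[of i] by (intro vec.span_scale) auto
    have "b = (\<Sum>i\<in>UNIV. b $ i *s column i P)"
      using fix_b[OF b] matrix_mult_sum[of P b] by simp
    then have "r b b = r (\<Sum>i\<in>UNIV. b $ i *s column i P) b" by simp
    also have "\<dots> = (\<Sum>i\<in>UNIV. r (b $ i *s column i P) b)"
      unfolding r_def using span by (subst vec.representation_sum[OF B(2)]) auto
    also have "\<dots> = (\<Sum>i\<in>UNIV. r (column i P) b * b $ i)"
      unfolding r_def using B(3) col
      by (intro sum.cong refl) (subst vec.representation_scale[OF B(2)], auto simp: mult.commute)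
    finally show ?thesis using vec.representation_basis[OF B(2) b] by (simp add: r_def)
  qed
  have "trace P = (\<Sum>i\<in>UNIV. column i P $ i)" by (simp add: trace_def column_def)
  also have "\<dots> = (\<Sum>i\<in>UNIV. (\<Sum>b\<in>B. r (column i P) b *s b) $ i)" by (simp add: exp)
  also have "\<dots> = (\<Sum>i\<in>UNIV. \<Sum>b\<in>B. r (column i P) b * b $ i)" by simp
  also have "\<dots> = (\<Sum>b\<in>B. 1)" by (subst sum.swap) (simp add: one)
  finally show ?thesis using B(4) by simp
qed

text \<open>
  The rank of a matrix is defined as its row rank, hence the passage to the transpose.
\<close>

lemma trace_idempotent:
  fixes P :: "'a::field^'n^'n"
  assumes P: "P ** P = P"
  shows "trace P = of_nat (rank P)"
proof -
  have "transpose P ** transpose P = transpose P"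
    using P by (metis matrix_transpose_mul)
  then have "trace (transpose P) = of_nat (vec.dim (columns (transpose P)))"
    by (rule trace_idempotent_columns)
  then show ?thesis by (simp add: row_rank_def_gen trace_def transpose_def columns_transpose[unfolded transpose_def])
qed

text \<open>
  The dimension of a subspace is the trace of the orthogonal projection onto it.
\<close>

lemma dim_eq_trace_projection:
  fixes f :: "'a::euclidean_space \<Rightarrow> 'a"
  assumes S: "subspace S" and f: "\<And>x. f x \<in> S" "\<And>x. x \<in> S \<Longrightarrow> f x = x"
    and sa: "\<And>x y. f x \<bullet> y = x \<bullet> f y"
  shows "real (dim S) = (\<Sum>b\<in>Basis. f b \<bullet> b)"
proof -
  obtain B where B: "B \<subseteq> S" "pairwise orthogonal B" "\<And>x. x \<in> B \<Longrightarrow> norm x = 1"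
    "independent B" "card B = dim S" "span B = S"
    using orthonormal_basis_subspace[OF S] by metis
  have fin: "finite B" using B(4) independent_imp_finite by blast
  have "f b \<bullet> b = (\<Sum>s\<in>B. (s \<bullet> b)\<^sup>2)" for b
  proof -
    have "f b = (\<Sum>s\<in>B. (s \<bullet> f b) *\<^sub>R s)"
      using orthonormal_basis_expand[OF B(2,3) _ fin, of "f b"] f(1)[of b] B(6) by (simp add: inner_commute)
    also have "\<dots> = (\<Sum>s\<in>B. (s \<bullet> b) *\<^sub>R s)"
      using B(1) f(2) sa by (intro sum.cong) (auto simp flip: sa)
    finally have "f b \<bullet> b = (\<Sum>s\<in>B. (s \<bullet> b) *\<^sub>R s) \<bullet> b" by simp
    then show ?thesis by (simp add: inner_sum_left power2_eq_square)
  qed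
  then have "(\<Sum>b\<in>Basis. f b \<bullet> b) = (\<Sum>b\<in>Basis. \<Sum>s\<in>B. (s \<bullet> b)\<^sup>2)" by simp
  also have "\<dots> = (\<Sum>s\<in>B. (norm s)\<^sup>2)"
    by (subst sum.swap) (simp only: power2_norm_eq_inner euclidean_inner[of s s for s] power2_eq_square[symmetric])
  finally show ?thesis using B(3,5) by simp
qed

lemma sum_Basis_vec:
  "(\<Sum>b\<in>(Basis :: ('a::euclidean_space^'n) set). g b) = (\<Sum>i\<in>UNIV. \<Sum>u\<in>Basis. g (axis i u))"
proof -
  have im: "(Basis :: ('a^'n) set) = (\<lambda>p. axis (fst p) (snd p)) ` (UNIV \<times> Basis)"
    by (force simp: Basis_vec_def)
  have "inj_on (\<lambda>p. axis (fst p) (snd p) :: 'a^'n) (UNIV \<times> Basis)"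
    by (auto simp: inj_on_def axis_eq_axis)
  from sum.reindex[OF this, of g]
  have "(\<Sum>b\<in>(Basis :: ('a^'n) set). g b) = (\<Sum>p\<in>UNIV \<times> Basis. g (axis (fst p) (snd p)))"
    unfolding im[symmetric] by (simp add: o_def)
  then show ?thesis by (simp add: sum.cartesian_product case_prod_unfold)
qed

lemma bounded_bilinear_matrix_mult:
  "bounded_bilinear ((**) :: 'a::{real_normed_field,euclidean_space}^'n^'m \<Rightarrow> 'a^'p^'n \<Rightarrow> 'a^'p^'m)"
  unfolding bilinear_conv_bounded_bilinear[symmetric] bilinear_def
  by (auto intro!: linearI simp: matrix_add_ldistrib vec_eq_iff matrix_matrix_mult_def
      sum.distrib algebra_simps scaleR_sum_right)


section \<open>Harmonic frames\<close>

text \<open>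
  A nontrivial character of the cyclic group of order \<open>k\<close> sums to zero.
\<close>

lemma sum_cis_roots:
  fixes j :: int and k :: nat
  assumes "k > 0" "\<not> int k dvd j"
  shows "(\<Sum>t<k. cis (2 * pi * real_of_int j * real t / real k)) = 0"
proof -
  define z where "z = cis (2 * pi * real_of_int j / real k)"
  have zt: "z ^ t = cis (2 * pi * real_of_int j * real t / real k)" for t
    unfolding z_def Complex.DeMoivre by (rule arg_cong[of _ _ cis]) simp
  have "z ^ k = cis (2 * pi * real_of_int j)" using zt[of k] assms(1) by simp
  also have "\<dots> = 1" by (simp add: cis_multiple_2pi)
  finally have zk: "z ^ k = 1" .
  have "z \<noteq> 1"
  proof
    assume "z = 1"
    then have "cos (2 * pi * real_of_int j / real k) = 1" by (simp add: z_def complex_eq_iff)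
    then obtain m :: int where "2 * pi * real_of_int j / real k = real_of_int m * 2 * pi"
      using cos_one_2pi_int by blast
    then have "real_of_int j = real_of_int (int k * m)" using assms(1) by (simp add: field_simps)
    then have "j = int k * m" by linarith
    then show False using assms(2) by simp
  qed
  then have "(\<Sum>t<k. z ^ t) = 0" by (simp add: geometric_sum zk)
  then show ?thesis by (simp add: zt)
qed

lemma sum_cos_roots:
  assumes "\<bar>j\<bar> < int k"
  shows "(\<Sum>t<k. cos (2 * pi * real_of_int j * real t / real k)) = (if j = 0 then real k else 0)"
proof (cases "j = 0")
  case False
  then have "\<not> int k dvd j" using assms by (auto dest: dvd_imp_le_int)
  moreover have "k > 0" using assms by simp
  ultimately show ?thesis
    using arg_cong[OF sum_cis_roots[of k j], of Re] False by simp
qed simp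

lemma sum_sin_roots:
  "(\<Sum>t<k. sin (2 * pi * real_of_int j * real t / real k)) = 0"
proof (cases "k > 0 \<and> \<not> int k dvd j")
  case True
  then show ?thesis using arg_cong[OF sum_cis_roots[of k j], of Im] by simp
next
  case False
  show ?thesis
  proof (cases "k = 0")
    case k: False
    then obtain m where m: "j = int k * m" using False by auto
    have "2 * pi * real_of_int j * real t / real k = real_of_int (m * int t) * 2 * pi" for t
      using k by (simp add: m)
    moreover have "sin (real_of_int (m * int t) * 2 * pi) = 0" for t
      by (metis sin_int_2pin mult.assoc mult.commute)
    ultimately show ?thesis by simp
  qed simp
qed

text \<open>
  A real unit norm tight frame of \<open>k\<close> vectors. With the frequencies \<open>s - (n-1)/2\<close>,
  \<open>0 \<le> s < n\<close>, and the functions \<open>cos + sin\<close> no distinction between even and odd \<open>n\<close> is needed: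
  \<open>(cos x + sin x) (cos y + sin y) = cos (x - y) + sin (x + y)\<close>, and \<open>x - y\<close>, \<open>x + y\<close> have
  integral frequencies. The frequencies are symmetric around zero, which gives rows of norm one.
\<close>

lemma harmonic_frame_exists:
  assumes nk: "CARD('n::finite) < CARD('k::finite)"
  shows "\<exists>F :: real^'n^'k. (\<forall>i. (\<Sum>j\<in>UNIV. (F $ i $ j)\<^sup>2) = 1) \<and>
    (\<forall>j l. (\<Sum>i\<in>UNIV. F $ i $ j * F $ i $ l) = (if j = l then real CARD('k) / real CARD('n) else 0))"
proof -
  define n where "n = CARD('n)"
  define k where "k = CARD('k)"
  have n: "0 < n" "n < k" using nk by (auto simp: n_def k_def)
  obtain e :: "'n \<Rightarrow> nat" where e: "bij_betw e UNIV {..<n}"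
    using ex_bij_betw_finite_nat[of "UNIV :: 'n set"] by (auto simp: n_def atLeast0LessThan)
  obtain f :: "'k \<Rightarrow> nat" where f: "bij_betw f UNIV {..<k}"
    using ex_bij_betw_finite_nat[of "UNIV :: 'k set"] by (auto simp: k_def atLeast0LessThan)
  define w where "w t = 2 * pi * real t / real k" for t
  have w: "2 * pi * real_of_int j * real t / real k = w t * real_of_int j" for j t
    by (simp add: w_def)
  define x where "x s t = w t * (real s - (real n - 1) / 2)" for s t
  define c where "c s t = cos (x s t) + sin (x s t)" for s t
  have prod: "c s t * c s' t = cos (2 * pi * real_of_int (int s - int s') * real t / real k)
      + sin (2 * pi * real_of_int (int s + int s' + 1 - int n) * real t / real k)" for s s' t
  proof -
    have "c s t * c s' t = cos (x s t - x s' t) + sin (x s t + x s' t)"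
      by (simp add: c_def cos_diff sin_add algebra_simps)
    moreover have "x s t - x s' t = w t * real_of_int (int s - int s')"
      by (simp add: x_def algebra_simps)
    moreover have "x s t + x s' t = w t * real_of_int (int s + int s' + 1 - int n)"
      by (simp add: x_def field_simps)
    ultimately show ?thesis by (simp only: w)
  qed
  have row: "(\<Sum>s<n. (c s t)\<^sup>2) = real n" for t
  proof -
    define g where "g s = sin (2 * x s t)" for s
    have "(\<Sum>s<n. g s) = (\<Sum>s<n. g (n - Suc s))" by (rule sum.nat_diff_reindex[symmetric])
    also have "\<dots> = (\<Sum>s<n. - g s)"
    proof (intro sum.cong refl)
      fix s assume "s \<in> {..<n}"
      then have "2 * x (n - Suc s) t = - (2 * x s t)"
        by (simp add: x_def of_nat_diff field_simps)
      then show "g (n - Suc s) = - g s" by (simp add: g_def)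
    qed
    finally have "(\<Sum>s<n. g s) = 0" by (simp add: sum_negf)
    moreover have "(c s t)\<^sup>2 = 1 + g s" for s
      by (simp add: c_def g_def sin_double power2_sum)
    ultimately show ?thesis by (simp add: sum.distrib)
  qed
  have col: "(\<Sum>t<k. c s t * c s' t) = (if s = s' then real k else 0)" if "s < n" "s' < n" for s s'
    using sum_cos_roots[of "int s - int s'" k] that n
    by (simp only: prod sum.distrib sum_sin_roots) auto
  define F :: "real^'n^'k" where "F = (\<chi> i j. c (e j) (f i) / sqrt (real n))"
  have "(\<Sum>j\<in>UNIV. (F $ i $ j)\<^sup>2) = 1" for i
  proof -
    have "(\<Sum>j\<in>UNIV. (F $ i $ j)\<^sup>2) = (\<Sum>j\<in>UNIV. (c (e j) (f i))\<^sup>2) / real n"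
      using n by (simp add: F_def power_divide sum_divide_distrib)
    also have "(\<Sum>j\<in>UNIV. (c (e j) (f i))\<^sup>2) = (\<Sum>s<n. (c s (f i))\<^sup>2)"
      by (rule sum.reindex_bij_betw[OF e])
    finally show ?thesis using n by (simp add: row)
  qed
  moreover have "(\<Sum>i\<in>UNIV. F $ i $ j * F $ i $ l) = (if j = l then real k / real n else 0)" for j l
  proof -
    have "(\<Sum>i\<in>UNIV. F $ i $ j * F $ i $ l) = (\<Sum>i\<in>UNIV. c (e j) (f i) * c (e l) (f i)) / real n"
      using n by (simp add: F_def sum_divide_distrib)
    also have "(\<Sum>i\<in>UNIV. c (e j) (f i) * c (e l) (f i)) = (\<Sum>t<k. c (e j) t * c (e l) t)"
      by (rule sum.reindex_bij_betw[OF f])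
    also have "\<dots> = (if e j = e l then real k else 0)"
      using e by (intro col) (auto dest: bij_betwE)
    also have "e j = e l \<longleftrightarrow> j = l" using e by (auto simp: bij_betw_def dest: injD)
    finally show ?thesis by simp
  qed
  ultimately show ?thesis unfolding n_def k_def by blast
qed


section \<open>Matrices over a field with conjugation\<close>

text \<open>
  The common features of \<open>\<real>\<close> with the identity and \<open>\<complex>\<close> with complex conjugation. The real
  part of \<open>x\<close> is \<open>1 \<bullet> x\<close>. The map \<open>cj\<close> is the identity on the line spanned by \<open>1\<close> and minus
  the identity on its orthogonal complement; the last assumption records its trace.
\<close>

locale conj_field =
  fixes cj :: "'a::{real_normed_field,euclidean_space} \<Rightarrow> 'a"
  assumes cj_add: "cj (x + y) = cj x + cj y"
    and cj_mult: "cj (x * y) = cj x * cj y"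
    and cj_cj [simp]: "cj (cj x) = x"
    and cj_scaleR: "cj (r *\<^sub>R x) = r *\<^sub>R cj x"
    and inner_cj: "x \<bullet> y = 1 \<bullet> (x * cj y)"
    and cj_fixed: "cj x = x \<Longrightarrow> x = of_real (1 \<bullet> x)"
    and cj_trace: "(\<Sum>u\<in>Basis. cj u \<bullet> u) = 2 - real DIM('a)"
begin

text \<open>
  The conjugate transpose.
\<close>

definition adj :: "'a^'n^'m \<Rightarrow> 'a^'m^'n" where
  "adj A = (\<chi> i j. cj (A $ j $ i))"

text \<open>
  The diagonal matrix with real entries \<open>a\<close>.
\<close>

definition diag_mat :: "real^'m \<Rightarrow> 'a^'m^'m" where
  "diag_mat a = (\<chi> i j. if i = j then of_real (a $ i) else 0)"

lemma cj_0 [simp]: "cj 0 = 0" using cj_scaleR[of 0 0] by simp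
lemma cj_minus: "cj (- x) = - cj x" using cj_scaleR[of "-1" x] by simp
lemma cj_diff: "cj (x - y) = cj x - cj y"
  using cj_add[of x "- y"] by (simp add: cj_minus)
lemma cj_sum: "cj (sum f S) = (\<Sum>x\<in>S. cj (f x))"
  by (induction S rule: infinite_finite_induct) (auto simp: cj_add)
lemma cj_1 [simp]: "cj 1 = 1"
proof -
  have "cj 1 * cj 1 = cj 1" using cj_mult[of 1 1] by simp
  moreover have "cj 1 \<noteq> 0" using cj_cj[of 1] by (metis cj_0 one_neq_zero)
  ultimately show ?thesis by simp
qed
lemma cj_of_real [simp]: "cj (of_real r) = of_real r"
  using cj_scaleR[of r 1] by (simp add: of_real_def)

lemma re_of_real [simp]: "(1::'a) \<bullet> of_real r = r"
  by (simp add: of_real_def norm_eq_sqrt_inner[of "1::'a", simplified])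
lemma inner_cj_cj: "cj x \<bullet> cj y = x \<bullet> y"
  using inner_cj[of "cj x" "cj y"] inner_cj[of y x] by (simp add: mult.commute inner_commute)
lemma inner_mult_cj: "(a * x) \<bullet> y = x \<bullet> (cj a * y)"
  using inner_cj[of "a * x" y] inner_cj[of x "cj a * y"] by (simp add: cj_mult mult_ac)
lemma mult_cj_self: "x * cj x = of_real ((norm x)\<^sup>2)"
proof -
  have "cj (x * cj x) = x * cj x" by (simp add: cj_mult mult.commute)
  then have "x * cj x = of_real (1 \<bullet> (x * cj x))" by (rule cj_fixed)
  then show ?thesis by (simp add: power2_norm_eq_inner inner_cj[of x x])
qed

lemma adj_adj [simp]: "adj (adj A) = A" by (simp add: adj_def vec_eq_iff)
lemma adj_add: "adj (A + B) = adj A + adj B" by (simp add: adj_def vec_eq_iff cj_add)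
lemma adj_diff: "adj (A - B) = adj A - adj B" by (simp add: adj_def vec_eq_iff cj_diff)
lemma adj_0 [simp]: "adj 0 = 0" by (simp add: adj_def vec_eq_iff)
lemma adj_scaleR: "adj (r *\<^sub>R A) = r *\<^sub>R adj A" by (simp add: adj_def vec_eq_iff cj_scaleR)
lemma adj_mat1 [simp]: "adj (mat 1) = mat 1" by (auto simp: adj_def mat_def vec_eq_iff)
lemma adj_mult: "adj (A ** B) = adj B ** adj A"
  by (simp add: adj_def matrix_matrix_mult_def vec_eq_iff cj_sum cj_mult mult.commute)
lemma adj_diag_mat [simp]: "adj (diag_mat a) = diag_mat a" by (auto simp: adj_def diag_mat_def vec_eq_iff)

lemma inner_adj: "adj A \<bullet> adj B = A \<bullet> B"
  by (simp add: inner_vec_def adj_def inner_cj_cj) (rule sum.swap)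

lemma inner_adj_left: "adj A \<bullet> B = A \<bullet> adj B"
  using inner_adj[of A "adj B"] by simp

lemma inner_mult_left: "(A ** X) \<bullet> Y = X \<bullet> (adj A ** Y)"
proof -
  have "(A ** X) \<bullet> Y = (\<Sum>i\<in>UNIV. \<Sum>j\<in>UNIV. \<Sum>l\<in>UNIV. (A $ i $ l * X $ l $ j) \<bullet> Y $ i $ j)"
    by (simp add: inner_vec_def matrix_matrix_mult_def inner_sum_left)
  also have "\<dots> = (\<Sum>i\<in>UNIV. \<Sum>j\<in>UNIV. \<Sum>l\<in>UNIV. X $ l $ j \<bullet> (cj (A $ i $ l) * Y $ i $ j))"
    by (simp add: inner_mult_cj)
  also have "\<dots> = (\<Sum>i\<in>UNIV. \<Sum>l\<in>UNIV. \<Sum>j\<in>UNIV. X $ l $ j \<bullet> (cj (A $ i $ l) * Y $ i $ j))"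
    by (intro sum.cong refl sum.swap)
  also have "\<dots> = (\<Sum>l\<in>UNIV. \<Sum>i\<in>UNIV. \<Sum>j\<in>UNIV. X $ l $ j \<bullet> (cj (A $ i $ l) * Y $ i $ j))"
    by (rule sum.swap)
  also have "\<dots> = (\<Sum>l\<in>UNIV. \<Sum>j\<in>UNIV. \<Sum>i\<in>UNIV. X $ l $ j \<bullet> (cj (A $ i $ l) * Y $ i $ j))"
    by (intro sum.cong refl sum.swap)
  also have "\<dots> = X \<bullet> (adj A ** Y)"
    by (simp add: inner_vec_def matrix_matrix_mult_def inner_sum_right adj_def)
  finally show ?thesis .
qed

lemma inner_mult_right: "(X ** A) \<bullet> Y = X \<bullet> (Y ** adj A)"
proof -
  have "(X ** A) \<bullet> Y = adj (X ** A) \<bullet> adj Y" by (simp add: inner_adj)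
  also have "\<dots> = adj X \<bullet> (A ** adj Y)" using inner_mult_left[of "adj A" "adj X" "adj Y"] by (simp add: adj_mult)
  also have "\<dots> = X \<bullet> (Y ** adj A)" using inner_adj_left[of X "A ** adj Y"] by (simp add: adj_mult)
  finally show ?thesis .
qed

lemma diag_mat_mult: "(diag_mat a ** A) $ i $ j = a $ i *\<^sub>R (A $ i $ j)"
  by (simp add: diag_mat_def matrix_matrix_mult_def if_distrib[of "\<lambda>x. x * y" for y] scaleR_conv_of_real cong: if_cong)

lemma mult_diag_mat: "(A ** diag_mat a) $ i $ j = a $ j *\<^sub>R (A $ i $ j)"
  by (simp add: diag_mat_def matrix_matrix_mult_def if_distrib[of "\<lambda>x. y * x" for y] scaleR_conv_of_real mult.commute cong: if_cong)

lemma inner_diag_mat: "diag_mat a \<bullet> S = (\<Sum>i\<in>UNIV. a $ i * (1 \<bullet> S $ i $ i))"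
proof -
  have "diag_mat a \<bullet> S = (\<Sum>i\<in>UNIV. \<Sum>j\<in>UNIV. if i = j then a $ i * (1 \<bullet> S $ i $ i) else 0)"
    unfolding inner_vec_def diag_mat_def by (intro sum.cong refl) (auto simp: of_real_def)
  then show ?thesis by simp
qed

text \<open>
  The skew-adjoint matrices form the range of the orthogonal projection \<open>X \<mapsto> (X - X\<^sup>*) / 2\<close>.
\<close>

lemma dim_skew:
  "real (dim {K :: 'a^'n^'n. adj K = - K})
    = (DIM('a) * (real CARD('n))\<^sup>2 - CARD('n) * (2 - real DIM('a))) / 2"
proof -
  define f :: "'a^'n^'n \<Rightarrow> 'a^'n^'n" where "f X = (1/2) *\<^sub>R (X - adj X)" for X
  have "real (dim {K :: 'a^'n^'n. adj K = - K}) = (\<Sum>b\<in>Basis. f b \<bullet> b)"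
  proof (rule dim_eq_trace_projection)
    show "subspace {K :: 'a^'n^'n. adj K = - K}"
      by (auto simp: subspace_def adj_add adj_scaleR)
    show "f X \<in> {K. adj K = - K}" for X
      by (simp add: f_def adj_scaleR adj_diff flip: scaleR_minus_right)
    show "f X = X" if "X \<in> {K. adj K = - K}" for X
      using that by (simp add: f_def flip: scaleR_2)
    show "f X \<bullet> Y = X \<bullet> f Y" for X Y
      by (simp add: f_def inner_diff_left inner_diff_right inner_adj_left)
  qed
  also have "\<dots> = (\<Sum>i\<in>(UNIV::'n set). \<Sum>j\<in>(UNIV::'n set). \<Sum>u\<in>Basis. (1 - (if i = j then cj u \<bullet> u else 0)) / 2)"
    unfolding sum_Basis_vec
  proof (intro sum.cong refl)
    fix i j :: 'n and u :: 'a assume u: "u \<in> Basis"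
    have "adj (axis i (axis j u)) $ i $ j = (if i = j then cj u else 0)"
      by (auto simp: adj_def axis_def)
    then show "f (axis i (axis j u)) \<bullet> axis i (axis j u) = (1 - (if i = j then cj u \<bullet> u else 0)) / 2"
      using u by (simp add: f_def inner_axis inner_diff_left)
  qed
  also have "\<dots> = (\<Sum>i\<in>(UNIV::'n set). \<Sum>j\<in>(UNIV::'n set).
      real DIM('a) / 2 - (if i = j then (2 - real DIM('a)) / 2 else 0))"
    by (intro sum.cong refl) (auto simp: diff_divide_distrib sum_subtractf cj_trace[symmetric] sum_divide_distrib)
  also have "\<dots> = (DIM('a) * (real CARD('n))\<^sup>2 - CARD('n) * (2 - real DIM('a))) / 2"
    by (simp add: sum_subtractf power2_eq_square algebra_simps diff_divide_distrib)
  finally show ?thesis .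
qed

text \<open>
  The only place where coprimality is used.
\<close>

lemma commuting_diagonal_const:
  fixes P :: "'a^'k^'k"
  assumes P: "P ** P = P" and diag: "\<And>i. P $ i $ i = of_real (real n / real CARD('k))"
    and cop: "coprime n CARD('k)" and comm: "diag_mat a ** P = P ** diag_mat a"
  shows "a $ i = a $ j"
proof -
  \<comment> \<open>The indicator of the level set of \<open>a\<close> through \<open>i\<close>; its diagonal matrix commutes with \<open>P\<close> as well.\<close>
  define b :: "real^'k" where "b = (\<chi> l. if a $ l = a $ i then 1 else 0)"
  have z: "a $ l = a $ m \<or> P $ l $ m = 0" for l m
  proof -
    have "a $ l *\<^sub>R P $ l $ m = a $ m *\<^sub>R P $ l $ m"
      unfolding diag_mat_mult[symmetric] mult_diag_mat[symmetric] by (simp only: comm)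
    then show ?thesis by (metis scaleR_cancel_right)
  qed
  have comm': "P ** diag_mat b = diag_mat b ** P"
    unfolding vec_eq_iff diag_mat_mult mult_diag_mat b_def using z by (auto, metis+)
  have "diag_mat b ** diag_mat b = diag_mat b"
    unfolding vec_eq_iff diag_mat_mult b_def by (simp add: diag_mat_def)
  then have "(diag_mat b ** P) ** (diag_mat b ** P) = diag_mat b ** P"
    using comm' P by (metis matrix_mul_assoc)
  then have "trace (diag_mat b ** P) = of_nat (rank (diag_mat b ** P))" by (rule trace_idempotent)
  moreover have "trace (diag_mat b ** P) = of_real (real (card {l. a $ l = a $ i}) * (real n / real CARD('k)))"
  proof -
    have "trace (diag_mat b ** P) = (\<Sum>l\<in>UNIV. of_real (if a $ l = a $ i then real n / real CARD('k) else 0))"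
      unfolding trace_def diag_mat_mult diag b_def by (intro sum.cong) (auto simp: scaleR_conv_of_real)
    also have "\<dots> = of_real (\<Sum>l\<in>UNIV. (if a $ l = a $ i then real n / real CARD('k) else 0))"
      by simp
    also have "(\<Sum>l\<in>UNIV. (if a $ l = a $ i then real n / real CARD('k) else 0))
        = real (card {l. a $ l = a $ i}) * (real n / real CARD('k))"
      by (simp add: sum.If_cases)
    finally show ?thesis .
  qed
  ultimately have "real (card {l. a $ l = a $ i}) * (real n / real CARD('k)) = real (rank (diag_mat b ** P))"
    by (metis of_real_eq_iff of_real_of_nat_eq)
  then have "real (card {l. a $ l = a $ i} * n) = real (CARD('k) * rank (diag_mat b ** P))"
    by (simp add: field_simps)
  then have "card {l. a $ l = a $ i} * n = CARD('k) * rank (diag_mat b ** P)"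
    using of_nat_eq_iff by blast
  then have "CARD('k) dvd card {l. a $ l = a $ i} * n" by simp
  then have "CARD('k) dvd card {l. a $ l = a $ i}"
    using cop by (simp add: coprime_commute coprime_dvd_mult_left_iff)
  moreover have "card {l. a $ l = a $ i} > 0" by (auto simp: card_gt_0_iff)
  moreover have "card {l. a $ l = a $ i} \<le> CARD('k)" by (intro card_mono) auto
  ultimately have "card {l. a $ l = a $ i} = CARD('k)" by (meson dvd_imp_le le_antisym)
  then have "{l. a $ l = a $ i} = UNIV" by (intro card_subset_eq) auto
  then show ?thesis by (metis UNIV_I mem_Collect_eq)
qed

interpretation mm: bounded_bilinear "(**) :: 'a^'n^'m \<Rightarrow> 'a^'p^'n \<Rightarrow> 'a^'p^'m"
  by (rule bounded_bilinear_matrix_mult)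

lemma diag_mat_const: "diag_mat (\<chi> i. l) = l *\<^sub>R mat 1"
  by (auto simp: diag_mat_def mat_def vec_eq_iff of_real_def)

lemma diag_mat_mult_row: "(diag_mat a ** F) $ i = a $ i *\<^sub>R (F $ i)"
  by (simp add: vec_eq_iff diag_mat_mult)

section \<open>Spherical tight frames\<close>

lemma frame_gram_projection:
  fixes F :: "'a^'n^'k"
  assumes F: "\<And>i. norm (F $ i) = 1" "adj F ** F = c *\<^sub>R mat 1"
    and c: "c = real CARD('k) / real CARD('n)"
  defines "P \<equiv> (1 / c) *\<^sub>R (F ** adj F)"
  shows "adj P = P" "P ** P = P" "\<And>i. P $ i $ i = of_real (real CARD('n) / real CARD('k))"
proof -
  have c0: "c > 0" using c by simp
  show "adj P = P" by (simp add: P_def adj_scaleR adj_mult)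
  have "(F ** adj F) ** (F ** adj F) = F ** (adj F ** F) ** adj F" by (simp add: matrix_mul_assoc)
  then have "(F ** adj F) ** (F ** adj F) = c *\<^sub>R (F ** adj F)"
    by (simp add: F(2) mm.scaleR_left mm.scaleR_right)
  then show "P ** P = P" using c0 by (simp add: P_def mm.scaleR_left mm.scaleR_right)
  show "P $ i $ i = of_real (real CARD('n) / real CARD('k))" for i
  proof -
    have "(F ** adj F) $ i $ i = (\<Sum>j\<in>UNIV. of_real ((norm (F $ i $ j))\<^sup>2))"
      by (simp add: matrix_matrix_mult_def adj_def mult_cj_self)
    also have "\<dots> = of_real (F $ i \<bullet> F $ i)"
      by (simp add: inner_vec_def power2_norm_eq_inner)
    also have "\<dots> = 1" using F(1)[of i] by (simp add: norm_eq_1)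
    finally show ?thesis by (simp add: P_def c of_real_def)
  qed
qed

text \<open>
  The map \<open>\<psi>\<close> collects the squared norms of the rows and \<open>F\<^sup>* F\<close>; the sphere product is cut out by
  its first component, which is why \<open>R\<close> is \<open>{0} \<times> UNIV\<close>.
\<close>

lemma frame_chart:
  fixes p :: "'a^'n^'k"
  assumes cop: "coprime CARD('n) CARD('k)"
    and c: "c = real CARD('k) / real CARD('n)"
    and p: "\<And>i. norm (p $ i) = 1" "adj p ** p = c *\<^sub>R mat 1"
  shows "\<exists>U \<phi> V W L. p \<in> U \<and> analytic_chart sphere_power U \<phi> V W \<and>
       subspace L \<and> L \<subseteq> W \<and>
       real (dim L) = DIM('a) * real CARD('n) * real CARD('k) - real CARD('k)
         - (DIM('a) * (real CARD('n))\<^sup>2 + CARD('n) * (2 - real DIM('a))) / 2 + 1 \<and>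
       \<phi> ` (U \<inter> {F. F \<in> sphere_power \<and> adj F ** F = c *\<^sub>R mat 1}) = V \<inter> L"
proof -
  define \<psi> :: "'a^'n^'k \<Rightarrow> (real^'k) \<times> ('a^'n^'n)"
    where "\<psi> F = ((\<chi> i. F $ i \<bullet> F $ i), adj F ** F)" for F
  define D :: "'a^'n^'k \<Rightarrow> (real^'k) \<times> ('a^'n^'n)"
    where "D h = ((\<chi> i. 2 * (p $ i \<bullet> h $ i)), adj p ** h + adj h ** p)" for h
  define Q :: "'a^'n^'k \<Rightarrow> 'a^'n^'k \<Rightarrow> (real^'k) \<times> ('a^'n^'n)"
    where "Q h h' = ((\<chi> i. h $ i \<bullet> h' $ i), adj h ** h')" for h h'
  have c0: "c > 0" using c by simp
  have expand: "\<psi> (p + h) = \<psi> p + D h + Q h h" for h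
    by (simp add: \<psi>_def D_def Q_def vec_eq_iff[of "\<chi> i. _ i"] inner_add_left inner_add_right
        inner_commute adj_add mm.add_left mm.add_right)
  have D: "linear D"
    by (rule linearI) (simp_all add: D_def vec_eq_iff[of "\<chi> i. _ i"] inner_add_right adj_add adj_scaleR
        mm.add_left mm.add_right mm.scaleR_left mm.scaleR_right algebra_simps)
  have Q: "bounded_bilinear Q"
    unfolding bilinear_conv_bounded_bilinear[symmetric] bilinear_def
    by (auto intro!: linearI simp: Q_def vec_eq_iff[of "\<chi> i. _ i"] inner_add_right inner_add_left adj_add adj_scaleR
        mm.add_left mm.add_right mm.scaleR_left mm.scaleR_right algebra_simps)
  have pair: "(a, H) \<bullet> D h = h \<bullet> (2 *\<^sub>R (diag_mat a ** p) + p ** (H + adj H))" for a H h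
  proof -
    have 1: "a \<bullet> (\<chi> i. 2 * (p $ i \<bullet> h $ i)) = h \<bullet> (2 *\<^sub>R (diag_mat a ** p))"
      by (simp add: inner_vec_def[of a] inner_vec_def[of h] diag_mat_mult_row inner_commute sum_distrib_left mult_ac)
    have 2: "H \<bullet> (adj p ** h) = h \<bullet> (p ** H)"
      using inner_mult_left[of "adj p" h H] by (simp add: inner_commute)
    have "H \<bullet> (adj h ** p) = adj H \<bullet> (adj p ** h)"
      using inner_adj[of H "adj h ** p"] by (simp add: adj_mult)
    also have "\<dots> = h \<bullet> (p ** adj H)"
      using inner_mult_left[of "adj p" h "adj H"] by (simp add: inner_commute)
    finally show ?thesis
      by (simp add: D_def 1 2 inner_add_right mm.add_right)
  qed
  define K where "K = {y. \<forall>h. y \<bullet> D h = 0}"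
  \<comment> \<open>The complement of the range of \<open>D\<close>: the scalar multiples of \<open>((1, \<dots>, 1), - I)\<close> plus the skew-adjoint matrices.\<close>
  have K: "(a, H) \<in> K \<longleftrightarrow> (\<exists>l. a = (\<chi> i. l) \<and> H + adj H = (- 2 * l) *\<^sub>R mat 1)" for a H
  proof
    assume "(a, H) \<in> K"
    then have "(2 *\<^sub>R (diag_mat a ** p) + p ** (H + adj H)) \<bullet> (2 *\<^sub>R (diag_mat a ** p) + p ** (H + adj H)) = 0"
      using pair[of a H "2 *\<^sub>R (diag_mat a ** p) + p ** (H + adj H)"] by (simp add: K_def)
    then have eq: "2 *\<^sub>R (diag_mat a ** p) + p ** (H + adj H) = 0" by simp
    \<comment> \<open>Multiplying by \<open>adj p\<close> from the right and comparing with the adjoint shows that \<open>diag_mat a\<close> commutes with the Gram matrix.\<close>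
    define G where "G = p ** adj p"
    have adjG: "adj G = G" by (simp add: G_def adj_mult)
    have "(2 *\<^sub>R (diag_mat a ** p) + p ** (H + adj H)) ** adj p = 0" by (simp add: eq mm.zero_left)
    then have e1: "2 *\<^sub>R (diag_mat a ** G) + p ** (H + adj H) ** adj p = 0"
      by (simp add: mm.add_left mm.scaleR_left G_def matrix_mul_assoc)
    have "adj (2 *\<^sub>R (diag_mat a ** G) + p ** (H + adj H) ** adj p) = 0" by (simp add: e1)
    then have "2 *\<^sub>R (G ** diag_mat a) + p ** (H + adj H) ** adj p = 0"
      by (simp add: adj_add adj_scaleR adj_mult adjG add.commute matrix_mul_assoc)
    with e1 have "2 *\<^sub>R (diag_mat a ** G) = 2 *\<^sub>R (G ** diag_mat a)" by (metis add_right_cancel)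
    then have comm: "diag_mat a ** G = G ** diag_mat a" by simp
    define P where "P = (1/c) *\<^sub>R G"
    have PP: "P ** P = P" and Pii: "P $ i $ i = of_real (real CARD('n) / real CARD('k))" for i
      using frame_gram_projection[OF p c] by (simp_all add: P_def G_def)
    have "diag_mat a ** P = P ** diag_mat a" by (simp add: P_def comm mm.scaleR_left mm.scaleR_right)
    then have "a $ i = a $ j" for i j
      using commuting_diagonal_const[OF PP Pii cop] by blast
    then obtain l where l: "a = (\<chi> i. l)" by (metis vec_lambda_unique)
    have "p ** (H + adj H + (2 * l) *\<^sub>R mat 1) = 0"
      using eq by (simp add: l diag_mat_const mm.scaleR_left mm.scaleR_right mm.add_right add.commute)
    then have "adj p ** (p ** (H + adj H + (2 * l) *\<^sub>R mat 1)) = 0" by (simp add: mm.zero_right)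
    then have "c *\<^sub>R (H + adj H + (2 * l) *\<^sub>R mat 1) = 0"
      by (simp only: matrix_mul_assoc p(2) mm.scaleR_left matrix_mul_lid)
    then have "H + adj H = (- 2 * l) *\<^sub>R mat 1" using c0 by (simp add: add_eq_0_iff2)
    then show "\<exists>l. a = (\<chi> i. l) \<and> H + adj H = (- 2 * l) *\<^sub>R mat 1" using l by blast
  next
    assume "\<exists>l. a = (\<chi> i. l) \<and> H + adj H = (- 2 * l) *\<^sub>R mat 1"
    then obtain l where l: "a = (\<chi> i. l)" "H + adj H = (- 2 * l) *\<^sub>R mat 1" by blast
    have "p ** (H + adj H) = (- 2 * l) *\<^sub>R p"
      by (simp only: l(2) mm.scaleR_right matrix_mul_rid)
    moreover have "diag_mat a ** p = l *\<^sub>R p"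
      by (simp only: l(1) diag_mat_const mm.scaleR_left matrix_mul_lid)
    ultimately have "2 *\<^sub>R (diag_mat a ** p) + p ** (H + adj H) = 0" by simp
    then show "(a, H) \<in> K" by (simp add: K_def pair)
  qed
  have dimK: "dim K = 1 + dim {X :: 'a^'n^'n. adj X = - X}"
  proof -
    define S where "S = {X :: 'a^'n^'n. adj X = - X}"
    have sS: "subspace S" by (auto simp: S_def subspace_def adj_add adj_scaleR)
    define g :: "real \<times> ('a^'n^'n) \<Rightarrow> (real^'k) \<times> ('a^'n^'n)"
      where "g q = ((\<chi> i. fst q), snd q - fst q *\<^sub>R mat 1)" for q
    have g: "linear g" by (rule linearI) (auto simp: g_def vec_eq_iff algebra_simps)
    have gi: "inj g"
      by (rule injI) (auto simp: g_def vec_eq_iff prod_eq_iff)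
    have "K = g ` (UNIV \<times> S)"
    proof (intro set_eqI iffI)
      fix y assume "y \<in> K"
      obtain a H where aH: "y = (a, H)" by (cases y)
      with \<open>y \<in> K\<close> have "\<exists>l. a = (\<chi> i. l) \<and> H + adj H = (- 2 * l) *\<^sub>R mat 1"
        using K by simp
      then obtain l where y: "y = ((\<chi> i. l), H)" "H + adj H = (- 2 * l) *\<^sub>R mat 1"
        using aH by blast
      have "adj (H + l *\<^sub>R mat 1) = (H + adj H) - H + l *\<^sub>R mat 1" by (simp add: adj_add adj_scaleR)
      also have "\<dots> = - (H + l *\<^sub>R mat 1)"
      proof -
        have "(- 2 * l) *\<^sub>R (mat 1 :: 'a^'n^'n) = - (l *\<^sub>R mat 1) - l *\<^sub>R mat 1"
          by (simp only: mult_2 mult_minus_left scaleR_left.minus scaleR_left.add) simp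
        then show ?thesis unfolding y(2) by simp
      qed
      finally have "H + l *\<^sub>R mat 1 \<in> S" by (simp add: S_def)
      moreover have "y = g (l, H + l *\<^sub>R mat 1)" by (simp add: g_def y)
      ultimately show "y \<in> g ` (UNIV \<times> S)" by blast
    next
      fix y assume "y \<in> g ` (UNIV \<times> S)"
      then obtain l X where y: "y = ((\<chi> i. l), X - l *\<^sub>R mat 1)" "adj X = - X"
        by (auto simp: g_def S_def)
      have "(X - l *\<^sub>R mat 1) + adj (X - l *\<^sub>R mat 1) = (- 2 * l) *\<^sub>R mat 1"
        by (simp only: adj_diff adj_scaleR y(2) adj_mat1 mult_2 mult_minus_left scaleR_left.minus scaleR_left.add) simp
      then show "y \<in> K" unfolding y(1) K by blast
    qed
    then have "dim K = dim ((UNIV :: real set) \<times> S)"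
      using dim_image_eq[OF g, of "UNIV \<times> S"] gi by (simp add: inj_on_subset)
    then show ?thesis using sS by (simp add: dim_Times S_def)
  qed
  have rng: "y \<bullet> (\<psi> x - \<psi> p) = 0" if "\<And>h. y \<bullet> D h = 0" for x y
  proof -
    obtain a H where y: "y = (a, H)" by (cases y)
    with that have "(a, H) \<in> K" by (simp add: K_def)
    then obtain l where l: "a = (\<chi> i. l)" "H + adj H = (- 2 * l) *\<^sub>R mat 1" using K by blast
    \<comment> \<open>Pairing with \<open>(a, H)\<close> annihilates \<open>\<psi>\<close>: the sum of the squared row norms is the trace of \<open>F\<^sup>* F\<close>.\<close>
    have sq: "H \<bullet> (adj F ** F) = - l * (F \<bullet> F)" for F :: "'a^'n^'k"
    proof -
      have "adj H \<bullet> (adj F ** F) = H \<bullet> (adj F ** F)"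
        by (simp add: inner_adj_left adj_mult)
      then have "2 * (H \<bullet> (adj F ** F)) = (H + adj H) \<bullet> (adj F ** F)" by (simp add: inner_add_left)
      also have "\<dots> = - 2 * l * (mat 1 \<bullet> (adj F ** F))" by (simp add: l(2))
      also have "mat 1 \<bullet> (adj F ** F) = F \<bullet> F"
        using inner_mult_left[of "adj F" F "mat 1"] by (simp add: inner_commute)
      finally show ?thesis by simp
    qed
    have "a \<bullet> (\<chi> i. F $ i \<bullet> F $ i) = l * (F \<bullet> F)" for F :: "'a^'n^'k"
      by (simp add: l(1) inner_vec_def[of "\<chi> i. l"] inner_vec_def[of F F] sum_distrib_left)
    then have "y \<bullet> \<psi> F = 0" for F using sq[of F] by (simp add: y \<psi>_def)
    then show ?thesis by (simp add: inner_diff_right)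
  qed
  have R: "subspace ({0} \<times> UNIV :: ((real^'k) \<times> ('a^'n^'n)) set)"
    by (intro subspace_Times subspace_UNIV subspace_single_0)
  have sph: "F \<in> sphere_power \<longleftrightarrow> fst (\<psi> F) = fst (\<psi> p)" for F
    by (simp add: sphere_power_def \<psi>_def vec_eq_iff norm_eq_1 p(1)[unfolded norm_eq_1])
  have dimD: "real (dim {h. D h = 0}) = DIM('a) * real CARD('n) * real CARD('k) - real CARD('k)
         - (DIM('a) * (real CARD('n))\<^sup>2 + CARD('n) * (2 - real DIM('a))) / 2 + 1"
  proof -
    have "dim {h. D h = 0} + (CARD('k) + CARD('n) * (CARD('n) * DIM('a)))
        = CARD('k) * (CARD('n) * DIM('a)) + (1 + dim {X :: 'a^'n^'n. adj X = - X})"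
      using dim_kernel_dual[OF D] by (simp flip: K_def add: dimK)
    then have "real (dim {h. D h = 0} + (CARD('k) + CARD('n) * (CARD('n) * DIM('a))))
        = real (CARD('k) * (CARD('n) * DIM('a)) + (1 + dim {X :: 'a^'n^'n. adj X = - X}))"
      by simp
    then show ?thesis
      using dim_skew[where 'n='n] by (simp add: field_simps power2_eq_square)
  qed
  have "\<exists>U \<phi> V W L. p \<in> U \<and> analytic_chart sphere_power U \<phi> V W \<and>
       subspace L \<and> L \<subseteq> W \<and> dim L = dim {h. D h = 0} \<and>
       \<phi> ` (U \<inter> {F. F \<in> sphere_power \<and> adj F ** F = c *\<^sub>R mat 1}) = V \<inter> L"
  proof (rule quadratic_slice_chart[OF expand D Q rng R open_UNIV UNIV_I])
    show "F \<in> sphere_power \<longleftrightarrow> \<psi> F - \<psi> p \<in> {0} \<times> UNIV" for F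
      unfolding sph by (auto simp: mem_Times_iff)
    show "F \<in> {F. F \<in> sphere_power \<and> adj F ** F = c *\<^sub>R mat 1} \<longleftrightarrow> \<psi> F = \<psi> p" for F
      unfolding mem_Collect_eq sph by (auto simp: prod_eq_iff \<psi>_def p(2))
  qed
  then show ?thesis by (simp only: dimD[symmetric] of_nat_eq_iff)
qed

lemma norm_cj: "norm (cj x) = norm x"
  by (simp add: norm_eq_sqrt_inner inner_cj_cj)

lemma inner_matrix_vector: "(A *v x) \<bullet> y = x \<bullet> (adj A *v y)"
proof -
  have "(A *v x) \<bullet> y = (\<Sum>i\<in>UNIV. \<Sum>j\<in>UNIV. x $ j \<bullet> (cj (A $ i $ j) * y $ i))"
    by (simp add: inner_vec_def matrix_vector_mult_def inner_sum_left inner_mult_cj)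
  also have "\<dots> = (\<Sum>j\<in>UNIV. \<Sum>i\<in>UNIV. x $ j \<bullet> (cj (A $ i $ j) * y $ i))" by (rule sum.swap)
  finally show ?thesis
    by (simp add: inner_vec_def matrix_vector_mult_def inner_sum_right adj_def)
qed

text \<open>
  Polarisation.
\<close>

lemma self_adjoint_form_zero:
  fixes H :: "'a^'n^'n"
  assumes H: "adj H = H" and z: "\<And>u. (H *v u) \<bullet> u = 0"
  shows "H = 0"
proof -
  have "H *v u = 0" for u
  proof -
    define w where "w = H *v u"
    have "(H *v (u + w)) \<bullet> (u + w) = (H *v u) \<bullet> w + (H *v w) \<bullet> u"
      using z[of u] z[of w] by (simp add: matrix_vector_right_distrib inner_add_left inner_add_right)
    also have "(H *v w) \<bullet> u = w \<bullet> (H *v u)" by (simp add: inner_matrix_vector H)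
    finally have "2 * (w \<bullet> w) = 0" using z[of "u + w"] by (simp add: w_def inner_commute)
    then show ?thesis by (simp add: w_def)
  qed
  then show ?thesis by (simp add: matrix_eq)
qed

text \<open>
  The coefficients \<open>\<langle>v, f\<^sub>i\<rangle>\<close> are the conjugates of the entries of \<open>F\<close> applied to the
  conjugate of \<open>v\<close>, so tightness says that \<open>F\<^sup>* F - B I\<close> has vanishing quadratic form.
\<close>

lemma tight_iff:
  fixes F :: "'a^'n^'k"
  shows "(\<forall>v. (\<Sum>i\<in>UNIV. (norm (\<Sum>j\<in>UNIV. v $ j * cj (F $ i $ j)))\<^sup>2) = B * (norm v)\<^sup>2)
    \<longleftrightarrow> adj F ** F = B *\<^sub>R mat 1"
proof -
  let ?c = "\<lambda>v :: 'a^'n. \<chi> j. cj (v $ j)"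
  let ?H = "adj F ** F - B *\<^sub>R mat 1"
  have cc: "?c (?c v) = v" for v by (simp add: vec_eq_iff)
  have nc: "(norm (?c v))\<^sup>2 = (norm v)\<^sup>2" for v
    by (simp add: power2_norm_eq_inner inner_vec_def inner_cj_cj)
  have coeffs: "(\<Sum>i\<in>UNIV. (norm (\<Sum>j\<in>UNIV. v $ j * cj (F $ i $ j)))\<^sup>2) = (F *v ?c v) \<bullet> (F *v ?c v)" for v
  proof -
    have "norm (\<Sum>j\<in>UNIV. v $ j * cj (F $ i $ j)) = norm ((F *v ?c v) $ i)" for i
      by (subst norm_cj[symmetric]) (simp add: matrix_vector_mult_def cj_sum cj_mult mult.commute)
    then show ?thesis by (simp add: inner_vec_def power2_norm_eq_inner)
  qed
  have form: "(F *v u) \<bullet> (F *v u) - B * (norm u)\<^sup>2 = (?H *v u) \<bullet> u" for u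
  proof -
    have "((adj F ** F) *v u) \<bullet> u = (F *v u) \<bullet> (F *v u)"
      by (simp add: inner_matrix_vector flip: matrix_vector_mul_assoc)
    moreover have "((B *\<^sub>R mat 1) *v u) = B *\<^sub>R u"
      by (simp add: vec_eq_iff matrix_vector_mult_def mat_def if_distrib[of "\<lambda>x. x * y" for y]
          if_distrib[of "\<lambda>x. B *\<^sub>R x"] cong: if_cong)
    ultimately show ?thesis
      by (simp add: matrix_vector_mult_diff_rdistrib inner_diff_left power2_norm_eq_inner)
  qed
  have eq: "(\<Sum>i\<in>UNIV. (norm (\<Sum>j\<in>UNIV. v $ j * cj (F $ i $ j)))\<^sup>2) = B * (norm v)\<^sup>2
      \<longleftrightarrow> (?H *v ?c v) \<bullet> ?c v = 0" for v
    by (simp only: coeffs form[symmetric] nc right_minus_eq)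
  have adjH: "adj ?H = ?H" by (simp add: adj_diff adj_mult adj_scaleR)
  show ?thesis
  proof
    assume "\<forall>v. (\<Sum>i\<in>UNIV. (norm (\<Sum>j\<in>UNIV. v $ j * cj (F $ i $ j)))\<^sup>2) = B * (norm v)\<^sup>2"
    then have "(?H *v u) \<bullet> u = 0" for u using eq[of "?c u"] unfolding cc by blast
    then have "?H = 0" by (rule self_adjoint_form_zero[OF adjH])
    then show "adj F ** F = B *\<^sub>R mat 1" by simp
  next
    assume "adj F ** F = B *\<^sub>R mat 1"
    then have "?H = 0" by simp
    then show "\<forall>v. (\<Sum>i\<in>UNIV. (norm (\<Sum>j\<in>UNIV. v $ j * cj (F $ i $ j)))\<^sup>2) = B * (norm v)\<^sup>2"
      unfolding eq by simp
  qed
qed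

text \<open>
  Comparing traces in \<open>F\<^sup>* F = B I\<close>.
\<close>

lemma frame_bound:
  fixes F :: "'a^'n^'k"
  assumes "\<And>i. norm (F $ i) = 1" "adj F ** F = B *\<^sub>R mat 1"
  shows "B = real CARD('k) / real CARD('n)"
proof -
  have m: "mat 1 \<bullet> (mat 1 :: 'a^'n^'n) = real CARD('n)"
    using inner_diag_mat[of "\<chi> i. 1" "mat 1 :: 'a^'n^'n"] re_of_real[of 1] by (simp add: diag_mat_const mat_def)
  have "mat 1 \<bullet> (adj F ** F) = F \<bullet> F"
    using inner_mult_left[of "adj F" F "mat 1"] by (simp add: inner_commute)
  moreover have "F \<bullet> F = real CARD('k)"
    using assms(1) by (simp add: inner_vec_def[of F F] norm_eq_1)
  ultimately have "B * real CARD('n) = real CARD('k)" by (simp add: assms(2) m)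
  then show ?thesis by (simp add: field_simps)
qed

lemma spherical_frame_exists:
  assumes "CARD('n::finite) < CARD('k::finite)"
  shows "\<exists>F :: 'a^'n^'k. (\<forall>i. norm (F $ i) = 1) \<and>
    adj F ** F = (real CARD('k) / real CARD('n)) *\<^sub>R mat 1"
proof -
  obtain F :: "real^'n^'k" where F: "\<And>i. (\<Sum>j\<in>UNIV. (F $ i $ j)\<^sup>2) = 1"
    "\<And>j l. (\<Sum>i\<in>UNIV. F $ i $ j * F $ i $ l) = (if j = l then real CARD('k) / real CARD('n) else 0)"
    using harmonic_frame_exists[OF assms] by blast
  define G :: "'a^'n^'k" where "G = (\<chi> i j. of_real (F $ i $ j))"
  have "(norm (G $ i))\<^sup>2 = (\<Sum>j\<in>UNIV. (F $ i $ j)\<^sup>2)" for i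
    by (simp add: G_def norm_vec_def L2_set_def sum_nonneg)
  then have "norm (G $ i) = 1" for i
    unfolding F(1) power2_eq_1_iff using norm_ge_zero[of "G $ i"] by fastforce
  moreover have "(adj G ** G) $ j $ l = of_real (\<Sum>i\<in>UNIV. F $ i $ j * F $ i $ l)" for j l
    by (simp add: G_def adj_def matrix_matrix_mult_def)
  then have "adj G ** G = (real CARD('k) / real CARD('n)) *\<^sub>R mat 1"
    unfolding vec_eq_iff F(2) by (simp add: mat_def of_real_def)
  ultimately show ?thesis by blast
qed

theorem tight_frames_submanifold:
  assumes cop: "coprime CARD('n::finite) CARD('k::finite)" and nk: "CARD('n) < CARD('k)"
  shows "\<exists>d. real d = DIM('a) * real CARD('n) * real CARD('k) - real CARD('k)
         - (DIM('a) * (real CARD('n))\<^sup>2 + CARD('n) * (2 - real DIM('a))) / 2 + 1 \<and>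
     regular_analytic_submanifold d {F :: 'a^'n^'k. F \<in> sphere_power \<and>
       (\<exists>B>0. \<forall>v. (\<Sum>i\<in>UNIV. (norm (\<Sum>j\<in>UNIV. v $ j * cj (F $ i $ j)))\<^sup>2) = B * (norm v)\<^sup>2)}
       sphere_power"
proof -
  let ?c = "real CARD('k) / real CARD('n)"
  let ?S = "{F :: 'a^'n^'k. F \<in> sphere_power \<and> adj F ** F = ?c *\<^sub>R mat 1}"
  have sph: "F \<in> sphere_power \<longleftrightarrow> (\<forall>i. norm (F $ i) = 1)" for F :: "'a^'n^'k"
    by (simp add: sphere_power_def)
  have "{F :: 'a^'n^'k. F \<in> sphere_power \<and>
       (\<exists>B>0. \<forall>v. (\<Sum>i\<in>UNIV. (norm (\<Sum>j\<in>UNIV. v $ j * cj (F $ i $ j)))\<^sup>2) = B * (norm v)\<^sup>2)} = ?S"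
    unfolding tight_iff
  proof (intro Collect_cong conj_cong refl iffI)
    fix F :: "'a^'n^'k" assume "F \<in> sphere_power" "\<exists>B>0. adj F ** F = B *\<^sub>R mat 1"
    then show "adj F ** F = ?c *\<^sub>R mat 1" using frame_bound[of F] sph by blast
  next
    fix F :: "'a^'n^'k" assume "adj F ** F = ?c *\<^sub>R mat 1"
    moreover have "?c > 0" by simp
    ultimately show "\<exists>B>0. adj F ** F = B *\<^sub>R mat 1" by blast
  qed
  moreover have "\<exists>d. real d = DIM('a) * real CARD('n) * real CARD('k) - real CARD('k)
         - (DIM('a) * (real CARD('n))\<^sup>2 + CARD('n) * (2 - real DIM('a))) / 2 + 1 \<and>
     regular_analytic_submanifold d ?S sphere_power"
  proof (rule regular_analytic_submanifoldI)
    show "?S \<noteq> {}" using spherical_frame_exists[OF nk] sph by blast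
    show "?S \<subseteq> sphere_power" by blast
  next
    fix p assume "p \<in> ?S"
    then have p: "\<And>i. norm (p $ i) = 1" "adj p ** p = ?c *\<^sub>R mat 1" by (auto simp: sph)
    show "\<exists>U \<phi> V W L. p \<in> U \<and> analytic_chart sphere_power U \<phi> V W \<and> subspace L \<and> L \<subseteq> W \<and>
       real (dim L) = DIM('a) * real CARD('n) * real CARD('k) - real CARD('k)
         - (DIM('a) * (real CARD('n))\<^sup>2 + CARD('n) * (2 - real DIM('a))) / 2 + 1 \<and>
       \<phi> ` (U \<inter> ?S) = V \<inter> L"
      by (rule frame_chart[OF cop refl p])
  qed
  ultimately show ?thesis by simp
qed

section \<open>Gram matrices\<close>

lemma re_of_nat: "(1::'a) \<bullet> of_nat r = real r"
  using re_of_real[of "real r"] by simp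

lemma trace_const_diag:
  fixes P :: "'a^'k^'k"
  assumes "\<And>i. P $ i $ i = of_real (real n / real CARD('k))"
  shows "trace P = of_nat n"
proof -
  have "trace P = of_real (\<Sum>i\<in>(UNIV::'k set). real n / real CARD('k))"
    by (simp add: trace_def assms)
  then show ?thesis by simp
qed

lemma inner_sandwich: "(R ** A ** S) \<bullet> B = A \<bullet> (adj R ** B ** adj S)"
  using inner_mult_right[of "R ** A" S B] inner_mult_left[of R A "B ** adj S"]
  by (simp add: matrix_mul_assoc)

text \<open>
  Self-adjoint matrices that are block off-diagonal with respect to \<open>P\<close> correspond to their upper
  right block \<open>P A Q\<close>, that is, to the range of the orthogonal projection \<open>A \<mapsto> P A Q\<close>. The trace of
  the latter only involves the diagonal entries of \<open>P\<close>.
\<close>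

lemma dim_offdiag:
  fixes P Q :: "'a^'k^'k"
  assumes P: "P ** P = P" "adj P = P" and Q: "Q = mat 1 - P"
    and diag: "\<And>i. P $ i $ i = of_real t"
  shows "real (dim {A. adj A = A \<and> P ** A ** P = 0 \<and> Q ** A ** Q = 0})
    = (real CARD('k))\<^sup>2 * DIM('a) * t * (1 - t)"
proof -
  have PQ: "P ** Q = 0" "Q ** P = 0" "Q ** Q = Q" "adj Q = Q"
    by (simp_all add: Q mm.diff_left mm.diff_right P adj_diff)
  have PQa: "P ** P = P" "Q ** Q = Q" "P ** Q = 0" "Q ** P = 0"
    "X ** P ** P = X ** P" "X ** Q ** Q = X ** Q" "X ** P ** Q = 0" "X ** Q ** P = 0" for X
    using P(1) PQ by (simp_all add: mm.zero_right flip: matrix_mul_assoc)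
  define T where "T = {A. adj A = A \<and> P ** A ** P = 0 \<and> Q ** A ** Q = 0}"
  define T' where "T' = {Y. P ** Y ** Q = Y}"
  define g where "g A = P ** A ** Q" for A
  have lg: "linear g"
    by (rule linearI) (simp_all add: g_def mm.add_left mm.add_right mm.scaleR_left mm.scaleR_right)
  have sT: "subspace T"
    by (auto simp: T_def subspace_def adj_add adj_scaleR mm.add_left mm.add_right mm.scaleR_left
        mm.scaleR_right mm.zero_left mm.zero_right)
  have sT': "subspace T'"
    by (auto simp: T'_def subspace_def mm.add_left mm.add_right mm.scaleR_left
        mm.scaleR_right mm.zero_left mm.zero_right)
  have spl: "A = P ** A ** P + P ** A ** Q + Q ** A ** P + Q ** A ** Q" for A
    by (simp add: Q mm.diff_left mm.diff_right)
  have decomp: "A = g A + adj (g A)" if "A \<in> T" for A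
  proof -
    have "P ** A ** P + P ** A ** Q + Q ** A ** P + Q ** A ** Q = g A + adj (g A)"
      using that by (simp add: T_def g_def adj_mult P PQ matrix_mul_assoc)
    then show ?thesis by (rule trans[OF spl])
  qed
  have "inj_on g T"
  proof (rule inj_onI)
    fix A B assume "A \<in> T" "B \<in> T" "g A = g B"
    then show "A = B" using decomp[of A] decomp[of B] by (simp only:)
  qed
  moreover have "g ` T = T'"
  proof (intro set_eqI iffI)
    fix Y assume "Y \<in> g ` T"
    then show "Y \<in> T'" by (auto simp: g_def T'_def matrix_mul_assoc PQa)
  next
    fix Y assume "Y \<in> T'"
    then have Y: "P ** Y ** Q = Y" by (simp add: T'_def)
    have aY: "adj Y = Q ** adj Y ** P" using arg_cong[OF Y, of adj] by (simp add: adj_mult P PQ matrix_mul_assoc)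
    have h: "P ** (P ** Y ** Q) = P ** Y ** Q" "(P ** Y ** Q) ** Q = P ** Y ** Q"
      "Q ** (P ** Y ** Q) = 0" "(P ** Y ** Q) ** P = 0"
      by (simp_all add: matrix_mul_assoc PQa mm.zero_left mm.zero_right)
    note z = h[unfolded Y]
    have z': "Q ** adj Y = adj Y" "adj Y ** P = adj Y" "P ** adj Y = 0" "adj Y ** Q = 0"
      using z[THEN arg_cong[of _ _ adj]] by (simp_all add: adj_mult P PQ)
    have "Y + adj Y \<in> T"
      by (simp add: T_def adj_add add.commute mm.add_left mm.add_right z z' PQ mm.zero_left mm.zero_right)
    moreover have "g (Y + adj Y) = Y"
      by (simp add: g_def mm.add_left mm.add_right z z' mm.zero_left)
    ultimately show "Y \<in> g ` T" by (metis imageI)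
  qed
  ultimately have "dim T = dim T'"
    using dim_image_eq[OF lg, of T] sT by (simp add: span_eq_iff[THEN iffD2])
  moreover have "real (dim T') = (\<Sum>b\<in>Basis. g b \<bullet> b)"
  proof (rule dim_eq_trace_projection[OF sT'])
    show "g A \<in> T'" for A by (simp add: g_def T'_def matrix_mul_assoc PQa)
    show "g A = A" if "A \<in> T'" for A using that by (simp add: g_def T'_def)
    show "g A \<bullet> B = A \<bullet> g B" for A B
      by (simp add: g_def inner_sandwich P PQ)
  qed
  moreover have "(\<Sum>b\<in>Basis. g b \<bullet> b) = (\<Sum>i\<in>(UNIV::'k set). \<Sum>j\<in>(UNIV::'k set). \<Sum>u\<in>(Basis::'a set). t * (1 - t))"
    unfolding sum_Basis_vec
  proof (intro sum.cong refl)
    fix i j :: 'k and u :: 'a assume u: "u \<in> Basis"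
    have "(P ** axis i (axis j u)) $ i $ m = (if m = j then P $ i $ i * u else 0)" for m
      by (simp add: matrix_matrix_mult_def axis_def if_distrib[of "\<lambda>x. x $ m"] if_distrib[of "\<lambda>x. y * x" for y]
          cong: if_cong)
    then have "g (axis i (axis j u)) $ i $ j = P $ i $ i * u * Q $ j $ j"
      by (simp add: g_def matrix_matrix_mult_def[of "P ** axis i (axis j u)"] if_distrib[of "\<lambda>x. x * y" for y] cong: if_cong)
    also have "\<dots> = (t * (1 - t)) *\<^sub>R u"
      by (simp add: Q diag mat_def scaleR_conv_of_real)
    finally show "g (axis i (axis j u)) \<bullet> axis i (axis j u) = t * (1 - t)"
      using u by (simp add: inner_axis)
  qed
  ultimately show ?thesis by (simp add: T_def power2_eq_square)
qed

text \<open>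
  Here \<open>s x\<close> is the self-adjoint part of \<open>x\<close> divided by \<open>c\<close>, so that \<open>s (c P) = P\<close>, and
  \<open>Z x\<close> is the defect of idempotency of \<open>s x\<close>. The diagonal \<open>dv\<close> is taken modulo constant
  vectors: near \<open>P\<close> the trace of an idempotent is fixed anyway, being an integer.
\<close>

lemma gram_chart:
  fixes P :: "'a^'k^'k" and n :: nat
  assumes n: "0 < n" "n < CARD('k)" and cop: "coprime n CARD('k)"
    and c: "c = real CARD('k) / real n"
    and P: "adj P = P" "P ** P = P" "\<And>i. P $ i $ i = of_real (real n / real CARD('k))"
  shows "\<exists>U \<phi> V W L. c *\<^sub>R P \<in> U \<and> analytic_chart UNIV U \<phi> V W \<and>
       subspace L \<and> L \<subseteq> W \<and>
       real (dim L) = DIM('a) * real n * (real CARD('k) - real n) - real CARD('k) + 1 \<and>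
       \<phi> ` (U \<inter> {c *\<^sub>R P | P. adj P = P \<and> P ** P = P \<and> rank P = n \<and>
             (\<forall>i. P $ i $ i = of_real (real n / real CARD('k)))}) = V \<inter> L"
proof -
  let ?k = "real CARD('k)"
  let ?S = "{c *\<^sub>R P | P. adj P = P \<and> P ** P = P \<and> rank P = n \<and>
             (\<forall>i. P $ i $ i = of_real (real n / ?k))}"
  define Q where "Q = mat 1 - P"
  have PQ: "P ** Q = 0" "Q ** P = 0" "Q ** Q = Q" "adj Q = Q"
    by (simp_all add: Q_def mm.diff_left mm.diff_right P adj_diff)
  have c0: "c > 0" using c n by simp
  define s :: "'a^'k^'k \<Rightarrow> 'a^'k^'k" where "s h = (1 / (2 * c)) *\<^sub>R (h + adj h)" for h
  have s: "linear s"
    by (rule linearI) (simp_all add: s_def adj_add adj_scaleR algebra_simps)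
  have adjs [simp]: "adj (s h) = s h" for h by (simp add: s_def adj_scaleR adj_add add.commute)
  have sp [simp]: "s (c *\<^sub>R R) = R" if "adj R = R" for R
  proof -
    have "s (c *\<^sub>R R) = (1 / (2 * c)) *\<^sub>R (c *\<^sub>R (2 *\<^sub>R R))"
      by (simp only: s_def adj_scaleR that scaleR_2 scaleR_add_right)
    then show ?thesis using c0 by simp
  qed
  have s_inner: "M \<bullet> s h = ((1 / (2 * c)) *\<^sub>R (M + adj M)) \<bullet> h" for M h
    by (simp add: s_def inner_add_left inner_add_right inner_adj_left)
  define dv :: "'a^'k^'k \<Rightarrow> real^'k"
    where "dv Y = (\<chi> i. 1 \<bullet> Y $ i $ i - (\<Sum>j\<in>UNIV. 1 \<bullet> Y $ j $ j) / ?k)" for Y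
  have dv: "linear dv"
    by (rule linearI) (simp_all add: dv_def vec_eq_iff inner_add_right sum.distrib add_divide_distrib
        sum_distrib_left[symmetric] right_diff_distrib)
  have dv_const: "dv Y = 0" if "\<And>i. Y $ i $ i = of_real t" for Y t
    by (simp add: dv_def that vec_eq_iff)
  have sum_dv: "(\<Sum>i\<in>UNIV. dv Y $ i) = 0" for Y
    by (simp add: dv_def sum_subtractf)
  define Z where "Z x = s x ** s x - s x" for x
  define \<psi> :: "'a^'k^'k \<Rightarrow> ('a^'k^'k) \<times> (real^'k)"
    where "\<psi> x = (x - adj x + P ** Z x ** P + Q ** Z x ** Q, dv (s x))" for x
  define D :: "'a^'k^'k \<Rightarrow> ('a^'k^'k) \<times> (real^'k)"
    where "D h = (h - adj h + P ** s h ** P - Q ** s h ** Q, dv (s h))" for h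
  define B :: "'a^'k^'k \<Rightarrow> 'a^'k^'k \<Rightarrow> ('a^'k^'k) \<times> (real^'k)"
    where "B h h' = (P ** (s h ** s h') ** P + Q ** (s h ** s h') ** Q, 0)" for h h'
  define p where "p = c *\<^sub>R P"
  have sp_p [simp]: "s p = P" by (simp add: p_def P)
  have adjp: "adj p = p" by (simp add: p_def adj_scaleR P)
  note bilin_simps = mm.add_left mm.add_right mm.diff_left mm.diff_right mm.scaleR_left mm.scaleR_right
    mm.zero_left mm.zero_right
  have PQa: "P ** P = P" "Q ** Q = Q" "P ** Q = 0" "Q ** P = 0"
    "X ** P ** P = X ** P" "X ** Q ** Q = X ** Q" "X ** P ** Q = 0" "X ** Q ** P = 0" for X
    using P(2) PQ by (simp_all add: mm.zero_right flip: matrix_mul_assoc)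
  have \<psi>p: "\<psi> p = 0"
    using dv_const[OF P(3)] by (simp add: \<psi>_def Z_def P bilin_simps p_def adj_scaleR zero_prod_def)
  have expand: "\<psi> (p + h) = \<psi> p + D h + B h h" for h
  proof -
    have "Z (p + h) = P ** s h + s h ** P - s h + s h ** s h"
      by (simp add: Z_def linear_add[OF s] bilin_simps P)
    then have "P ** Z (p + h) ** P = P ** s h ** P + P ** (s h ** s h) ** P"
      "Q ** Z (p + h) ** Q = - (Q ** s h ** Q) + Q ** (s h ** s h) ** Q"
      by (simp_all add: bilin_simps matrix_mul_assoc PQa)
    moreover have "dv P = 0" using dv_const[OF P(3)] .
    ultimately show ?thesis
      by (simp add: \<psi>p D_def B_def \<psi>_def[of "p + h"] linear_add[OF s] linear_add[OF dv] adj_add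
          adjp)
  qed
  have D: "linear D"
    by (rule linearI) (simp_all add: D_def linear_add[OF s] linear_add[OF dv] linear_scale[OF s]
        linear_scale[OF dv] adj_add adj_scaleR bilin_simps algebra_simps)
  have B: "bounded_bilinear B"
    unfolding bilinear_conv_bounded_bilinear[symmetric] bilinear_def
    by (auto intro!: linearI simp: B_def linear_add[OF s] linear_scale[OF s] bilin_simps algebra_simps)
  \<comment> \<open>The adjoint of \<open>dv\<close> subtracts the mean.\<close>
  define cen :: "real^'k \<Rightarrow> real^'k" where "cen d = (\<chi> i. d $ i - (\<Sum>j\<in>UNIV. d $ j) / ?k)" for d
  have inner_dv: "d \<bullet> dv Y = diag_mat (cen d) \<bullet> Y" for d Y
  proof -
    define t where "t = (\<Sum>j\<in>UNIV. 1 \<bullet> Y $ j $ j)"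
    have "d \<bullet> dv Y = (\<Sum>i\<in>UNIV. d $ i * (1 \<bullet> Y $ i $ i - t / ?k))"
      by (simp add: inner_vec_def dv_def t_def)
    also have "\<dots> = (\<Sum>i\<in>UNIV. d $ i * (1 \<bullet> Y $ i $ i)) - (\<Sum>i\<in>UNIV. d $ i) * (t / ?k)"
      by (simp only: right_diff_distrib sum_subtractf sum_distrib_right)
    also have "\<dots> = (\<Sum>i\<in>UNIV. d $ i * (1 \<bullet> Y $ i $ i)) - (\<Sum>i\<in>UNIV. d $ i) / ?k * t"
      by simp
    also have "\<dots> = diag_mat (cen d) \<bullet> Y"
      by (simp add: inner_diag_mat cen_def t_def left_diff_distrib sum_subtractf sum_distrib_left)
    finally show ?thesis .
  qed
  define M where "M A d = P ** A ** P - Q ** A ** Q + diag_mat (cen d)" for A d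
  have pair: "(A, d) \<bullet> D h = ((A - adj A) + (1 / (2 * c)) *\<^sub>R (M A d + adj (M A d))) \<bullet> h" for A d h
  proof -
    have "A \<bullet> (P ** s h ** P) = (P ** A ** P) \<bullet> s h" "A \<bullet> (Q ** s h ** Q) = (Q ** A ** Q) \<bullet> s h"
      by (simp_all add: inner_sandwich P PQ)
    then have "(A, d) \<bullet> D h = (A - adj A) \<bullet> h + M A d \<bullet> s h"
      by (simp add: D_def M_def inner_dv inner_add_left inner_diff_left inner_add_right inner_diff_right
          inner_adj_left)
    then show ?thesis unfolding s_inner by (simp add: inner_add_left)
  qed
  define K where "K = {y. \<forall>h. y \<bullet> D h = 0}"
  define T where "T = {A. adj A = A \<and> P ** A ** P = 0 \<and> Q ** A ** Q = 0}"
  \<comment> \<open>The complement of the range of \<open>D\<close>.\<close>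
  have K: "(A, d) \<in> K \<longleftrightarrow> A \<in> T \<and> (\<exists>l. d = (\<chi> i. l))" for A d
  proof
    assume "(A, d) \<in> K"
    define X where "X = (1 / (2 * c)) *\<^sub>R (M A d + adj (M A d))"
    have "((A - adj A) + X) \<bullet> ((A - adj A) + X) = 0"
      using \<open>(A, d) \<in> K\<close> pair[of A d "(A - adj A) + X"] by (simp add: K_def X_def)
    then have e1: "(A - adj A) + X = 0" by simp
    have "adj X = X" by (simp add: X_def adj_scaleR adj_add add.commute)
    \<comment> \<open>The skew-adjoint and the self-adjoint part vanish separately.\<close>
    with e1 have e2: "(adj A - A) + X = 0"
      by (metis adj_add adj_adj adj_diff adj_0)
    have "2 *\<^sub>R X = ((A - adj A) + X) + ((adj A - A) + X)" by (simp add: scaleR_2)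
    then have X0: "X = 0" using e1 e2 by simp
    with e1 have A: "adj A = A" by simp
    have "adj (M A d) = M A d"
      by (simp add: M_def adj_add adj_diff adj_mult A P PQ matrix_mul_assoc)
    with X0 c0 have M0: "M A d = 0" by (simp add: X_def flip: scaleR_2)
    \<comment> \<open>The off-diagonal block of \<open>M A d\<close> is that of a diagonal matrix, which therefore commutes with \<open>P\<close>.\<close>
    have "P ** M A d ** Q = 0" by (simp add: M0 bilin_simps)
    then have "P ** diag_mat (cen d) ** Q = 0"
      by (simp add: M_def bilin_simps matrix_mul_assoc PQa)
    then have r: "P ** diag_mat (cen d) = P ** diag_mat (cen d) ** P" by (simp add: Q_def bilin_simps)
    have "diag_mat (cen d) ** P = adj (P ** diag_mat (cen d))" by (simp add: adj_mult P)
    also have "\<dots> = adj (P ** diag_mat (cen d) ** P)" using r by simp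
    also have "\<dots> = P ** diag_mat (cen d) ** P" by (simp add: adj_mult P matrix_mul_assoc)
    also have "\<dots> = P ** diag_mat (cen d)" using r by simp
    finally have "cen d $ i = cen d $ j" for i j
      using commuting_diagonal_const[OF P(2,3) cop] by blast
    then have "d $ i = d $ j" for i j by (simp add: cen_def)
    then obtain l where l: "d = (\<chi> i. l)" by (metis vec_lambda_unique)
    then have "diag_mat (cen d) = 0" by (simp add: cen_def diag_mat_def vec_eq_iff)
    then have "P ** A ** P - Q ** A ** Q = 0" using M0 by (simp add: M_def)
    then have "P ** (P ** A ** P - Q ** A ** Q) ** P = 0" "Q ** (P ** A ** P - Q ** A ** Q) ** Q = 0"
      by (simp_all add: bilin_simps)
    then have "P ** A ** P = 0" "Q ** A ** Q = 0"
      by (simp_all add: bilin_simps mm.minus_left mm.minus_right matrix_mul_assoc PQa)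
    then show "A \<in> T \<and> (\<exists>l. d = (\<chi> i. l))" using A l by (auto simp: T_def)
  next
    assume "A \<in> T \<and> (\<exists>l. d = (\<chi> i. l))"
    then obtain l where A: "adj A = A" "P ** A ** P = 0" "Q ** A ** Q = 0" and l: "d = (\<chi> i. l)"
      by (auto simp: T_def)
    then have "diag_mat (cen d) = 0" by (simp add: cen_def diag_mat_def vec_eq_iff)
    then show "(A, d) \<in> K" by (simp add: K_def pair M_def A)
  qed
  have dimK: "dim K = dim T + 1"
  proof -
    have sT: "subspace T"
      by (auto simp: T_def subspace_def adj_add adj_scaleR bilin_simps)
    define g :: "real \<Rightarrow> real^'k" where "g l = (\<chi> i. l)" for l
    have g: "linear g" by (rule linearI) (simp_all add: g_def vec_eq_iff)
    have "inj g" by (rule injI) (simp add: g_def vec_eq_iff)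
    then have "dim (range g) = 1" using dim_image_eq[OF g, of UNIV] by simp
    moreover have "K = T \<times> range g" using K by (auto simp: g_def)
    ultimately show ?thesis using dim_Times[OF sT linear_subspace_image[OF g subspace_UNIV]] by simp
  qed
  have rng: "y \<bullet> (\<psi> x - \<psi> p) = 0" if "\<And>h. y \<bullet> D h = 0" for x y
  proof -
    obtain A d where y: "y = (A, d)" by (cases y)
    with that have "(A, d) \<in> K" by (simp add: K_def)
    then obtain l where A: "adj A = A" "P ** A ** P = 0" "Q ** A ** Q = 0" and l: "d = (\<chi> i. l)"
      unfolding K by (auto simp: T_def)
    have "A \<bullet> (P ** Z x ** P) = (P ** A ** P) \<bullet> Z x" "A \<bullet> (Q ** Z x ** Q) = (Q ** A ** Q) \<bullet> Z x"
      by (simp_all add: inner_sandwich P PQ)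
    moreover have "d \<bullet> dv (s x) = 0"
      using sum_dv[of "s x"] by (simp add: l inner_vec_def flip: sum_distrib_left)
    moreover have "A \<bullet> (x - adj x) = 0"
      using inner_adj_left[of A x] by (simp add: A inner_diff_right)
    ultimately show ?thesis
      by (simp add: \<psi>p y \<psi>_def[of x] A inner_add_right)
  qed
  obtain m where m: "m > 0" "\<And>(X :: 'a^'k^'k) (Y :: 'a^'k^'k). norm (X ** Y) \<le> norm X * norm Y * m"
    using bounded_bilinear.pos_bounded[OF bounded_bilinear_matrix_mult] by blast
  have m3: "norm (X ** Y ** V) \<le> norm X * norm Y * m * norm V * m" for X Y V :: "'a^'k^'k"
  proof -
    have "norm (X ** Y) * norm V * m \<le> norm X * norm Y * m * norm V * m"
      by (intro mult_right_mono m(2)) (use m(1) in auto)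
    then show ?thesis using m(2)[of "X ** Y" V] by (rule order_trans[rotated])
  qed
  \<comment> \<open>For \<open>s x\<close> in the \<open>\<epsilon>\<close>-ball around \<open>P\<close> the map \<open>W \<mapsto> W E Q - P E W\<close> with \<open>E = s x - P\<close> has norm below 1, and the real part of the trace of \<open>E\<close> is below 1 in absolute value.\<close>
  define \<epsilon> where "\<epsilon> = 1 / (m\<^sup>2 * (norm P + norm Q) + norm (mat 1 :: 'a^'k^'k) + 1)"
  have den: "m\<^sup>2 * (norm P + norm Q) + norm (mat 1 :: 'a^'k^'k) + 1 > 0"
    by (smt (verit) norm_ge_zero mult_nonneg_nonneg zero_le_power2)
  have \<epsilon>0: "\<epsilon> > 0" using den by (simp add: \<epsilon>_def)
  have \<epsilon>: "m\<^sup>2 * (norm P + norm Q) * e < 1" "norm (mat 1 :: 'a^'k^'k) * e < 1" if "0 \<le> e" "e < \<epsilon>" for e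
  proof -
    have "(m\<^sup>2 * (norm P + norm Q) + norm (mat 1 :: 'a^'k^'k) + 1) * e < 1"
      using that(2) den by (simp add: \<epsilon>_def field_simps)
    then have "m\<^sup>2 * (norm P + norm Q) * e + norm (mat 1 :: 'a^'k^'k) * e + e < 1"
      by (simp only: distrib_right mult_1_left)
    moreover have "0 \<le> m\<^sup>2 * (norm P + norm Q) * e" "0 \<le> norm (mat 1 :: 'a^'k^'k) * e"
      using that(1) by simp_all
    ultimately show "m\<^sup>2 * (norm P + norm Q) * e < 1" "norm (mat 1 :: 'a^'k^'k) * e < 1"
      using that(1) by linarith+
  qed
  define N where "N = {x. norm (s x - P) < \<epsilon>}"
  have "continuous_on UNIV (\<lambda>x. norm (s x - P))"
    by (intro continuous_intros linear_continuous_on linear_conv_bounded_linear[THEN iffD1] s)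
  then have N: "open N" unfolding N_def
    by (intro open_Collect_less) (auto intro: continuous_intros)
  have pN: "p \<in> N" using \<epsilon>0 by (simp add: N_def)
  have level: "x \<in> ?S \<longleftrightarrow> \<psi> x = \<psi> p" if x: "x \<in> N" for x
  proof
    assume "x \<in> ?S"
    then obtain R where R: "x = c *\<^sub>R R" "adj R = R" "R ** R = R" "\<And>i. R $ i $ i = of_real (real n / ?k)"
      by blast
    have sx: "s x = R" and adjx: "adj x = x" by (simp_all add: R adj_scaleR)
    show "\<psi> x = \<psi> p"
      using dv_const[OF R(4)] by (simp add: \<psi>p \<psi>_def[of x] Z_def sx adjx R(3) bilin_simps zero_prod_def)
  next
    assume "\<psi> x = \<psi> p"
    then have e1: "x - adj x + (P ** Z x ** P + Q ** Z x ** Q) = 0" and dv0: "dv (s x) = 0"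
      by (simp_all add: \<psi>p \<psi>_def[of x] prod_eq_iff add.assoc)
    define R where "R = s x"
    define E where "E = R - P"
    have R: "adj R = R" by (simp add: R_def)
    have adjZ: "adj (Z x) = Z x" by (simp add: Z_def adj_diff adj_mult)
    define X where "X = P ** Z x ** P + Q ** Z x ** Q"
    have "adj X = X" by (simp add: X_def adj_add adj_mult adjZ P PQ matrix_mul_assoc)
    with e1 have e2: "adj x - x + X = 0"
      unfolding X_def[symmetric] by (metis adj_add adj_adj adj_diff adj_0)
    have "2 *\<^sub>R X = (x - adj x + X) + (adj x - x + X)" by (simp add: scaleR_2)
    then have X0: "X = 0" using e1 e2 by (simp add: X_def)
    with e2 have xadj: "adj x = x" by simp
    have xR: "x = c *\<^sub>R R"
      using c0 by (simp add: R_def s_def xadj flip: scaleR_2)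
    have "P ** X ** P = 0" "Q ** X ** Q = 0" by (simp_all add: X0 bilin_simps)
    then have PZP: "P ** Z x ** P = 0" and QZQ: "Q ** Z x ** Q = 0"
      by (simp_all add: X_def bilin_simps matrix_mul_assoc PQa)
    \<comment> \<open>The off-diagonal block of \<open>Z x\<close> vanishes too, because \<open>s x\<close> commutes with \<open>Z x\<close> and \<open>E\<close> is small.\<close>
    define W where "W = P ** Z x ** Q"
    have spl: "Y = P ** Y ** P + P ** Y ** Q + Q ** Y ** P + Q ** Y ** Q" for Y
      by (simp add: Q_def bilin_simps)
    have ZQ: "Z x ** Q = W"
    proof -
      have "Z x ** Q = P ** Z x ** Q + Q ** Z x ** Q" by (simp add: Q_def bilin_simps)
      then show ?thesis by (simp add: W_def QZQ)
    qed
    have PZ: "P ** Z x = W"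
    proof -
      have "P ** Z x = P ** Z x ** P + P ** Z x ** Q" by (simp add: Q_def bilin_simps)
      then show ?thesis by (simp add: W_def PZP)
    qed
    have RZ: "R ** Z x = Z x ** R" by (simp add: Z_def R_def[symmetric] bilin_simps matrix_mul_assoc)
    have "P ** R ** W = P ** (R ** Z x) ** Q" by (simp add: ZQ flip: matrix_mul_assoc)
    also have "\<dots> = W ** R ** Q" by (simp add: RZ PZ matrix_mul_assoc)
    finally have comm: "P ** R ** W = W ** R ** Q" .
    have lhs: "P ** R ** W = W + P ** E ** W"
      by (simp add: E_def bilin_simps P(2)) (simp add: W_def matrix_mul_assoc PQa)
    have rhs: "W ** R ** Q = W ** E ** Q"
      by (simp add: E_def bilin_simps) (simp add: W_def PQa)
    have "W + P ** E ** W = W ** E ** Q"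
      by (rule trans[OF lhs[symmetric] trans[OF comm rhs]])
    then have W: "W = W ** E ** Q - P ** E ** W" by (simp only: eq_diff_eq)
    have nE: "norm E < \<epsilon>" using x by (simp add: N_def E_def R_def)
    have "norm W \<le> norm (W ** E ** Q) + norm (P ** E ** W)"
      using norm_triangle_ineq4[of "W ** E ** Q" "P ** E ** W"] by (simp only: W[symmetric])
    also have "norm (W ** E ** Q) \<le> (norm W * norm E * m) * norm Q * m"
      by (rule m3)
    also have "norm (P ** E ** W) \<le> (norm P * norm E * m) * norm W * m"
      by (rule m3)
    finally have "norm W \<le> (m\<^sup>2 * (norm P + norm Q) * norm E) * norm W"
      by (simp add: algebra_simps power2_eq_square)
    moreover have "m\<^sup>2 * (norm P + norm Q) * norm E < 1" using \<epsilon>(1) nE by simp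
    ultimately have "\<not> norm W > 0"
      using mult_strict_right_mono[of "m\<^sup>2 * (norm P + norm Q) * norm E" 1 "norm W"]
      unfolding mult_1_left by linarith
    then have W0: "W = 0" by simp
    have "Q ** Z x ** P = adj W" by (simp add: W_def adj_mult adjZ P PQ matrix_mul_assoc)
    then have "P ** Z x ** P + P ** Z x ** Q + Q ** Z x ** P + Q ** Z x ** Q = 0"
      by (simp add: PZP QZQ W0 flip: W_def)
    then have "Z x = 0" by (rule trans[OF spl])
    then have RR: "R ** R = R" by (simp add: Z_def R_def)
    \<comment> \<open>The trace of \<open>R\<close> is the integer \<open>rank R\<close> and differs from \<open>n\<close> by less than 1.\<close>
    have tr: "trace R = of_nat (rank R)" by (rule trace_idempotent[OF RR])
    have m1: "mat 1 \<bullet> Y = 1 \<bullet> trace Y" for Y :: "'a^'k^'k"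
      using inner_diag_mat[of "\<chi> i. 1" Y] by (simp add: diag_mat_const trace_def inner_sum_right)
    have "mat 1 \<bullet> E = real (rank R) - real n"
      unfolding E_def inner_diff_right m1 tr trace_const_diag[OF P(3)]
      by (simp only: re_of_nat)
    moreover have "\<bar>mat 1 \<bullet> E\<bar> \<le> norm (mat 1 :: 'a^'k^'k) * norm E" by (rule Cauchy_Schwarz_ineq2)
    moreover have "norm (mat 1 :: 'a^'k^'k) * norm E < 1" using \<epsilon>(2) nE by simp
    ultimately have rank: "rank R = n" by linarith
    have diag: "R $ i $ i = of_real (real n / ?k)" for i
    proof -
      have "cj (R $ i $ i) = R $ i $ i" using arg_cong[OF R, of "\<lambda>X. X $ i $ i"] by (simp add: adj_def)
      then have 1: "R $ i $ i = of_real (1 \<bullet> R $ i $ i)" by (rule cj_fixed)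
      have "1 \<bullet> R $ i $ i = (\<Sum>j\<in>UNIV. 1 \<bullet> R $ j $ j) / ?k"
        using arg_cong[OF dv0, of "\<lambda>v. v $ i"] by (simp add: dv_def R_def)
      also have "(\<Sum>j\<in>UNIV. 1 \<bullet> R $ j $ j) = 1 \<bullet> trace R" by (simp add: trace_def inner_sum_right)
      also have "\<dots> = real n" unfolding tr rank by (simp only: re_of_nat)
      finally have "1 \<bullet> R $ i $ i = real n / ?k" .
      then have "of_real (1 \<bullet> R $ i $ i) = (of_real (real n / ?k) :: 'a)" by (rule arg_cong)
      then show ?thesis by (rule trans[OF 1])
    qed
    show "x \<in> ?S" using xR R RR rank diag by (intro CollectI exI[of _ R] conjI allI)
  qed
  have dimD: "real (dim {h. D h = 0}) = DIM('a) * real n * (?k - real n) - ?k + 1"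
  proof -
    have "dim {h. D h = 0} + CARD('k) = dim T + 1"
      using dim_kernel_dual[OF D] by (simp flip: K_def add: dimK)
    then have d1: "real (dim {h. D h = 0}) + ?k = real (dim T) + 1" by linarith
    have "real (dim T) = ?k\<^sup>2 * DIM('a) * (real n / ?k) * (1 - real n / ?k)"
      unfolding T_def by (rule dim_offdiag[OF P(2,1) Q_def P(3)])
    moreover have "\<dots> = DIM('a) * real n * (?k - real n)"
      by (simp add: field_simps power2_eq_square)
    ultimately show ?thesis using d1 by linarith
  qed
  have "\<exists>U \<phi> V W L. p \<in> U \<and> analytic_chart UNIV U \<phi> V W \<and>
       subspace L \<and> L \<subseteq> W \<and> dim L = dim {h. D h = 0} \<and> \<phi> ` (U \<inter> ?S) = V \<inter> L"
    by (rule quadratic_slice_chart[OF expand D B rng subspace_UNIV N pN]) (use level in auto)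
  then show ?thesis unfolding p_def by (simp only: dimD[symmetric] of_nat_eq_iff)
qed

theorem gram_matrices_submanifold:
  assumes cop: "coprime CARD('n::finite) CARD('k::finite)" and nk: "CARD('n) < CARD('k)"
  shows "\<exists>d. real d = DIM('a) * real CARD('n) * (real CARD('k) - real CARD('n)) - real CARD('k) + 1 \<and>
     regular_analytic_submanifold d {(real CARD('k) / real CARD('n)) *\<^sub>R P | P :: 'a^'k^'k.
       adj P = P \<and> P ** P = P \<and> rank P = CARD('n) \<and>
       (\<forall>i. P $ i $ i = of_real (real CARD('n) / real CARD('k)))} UNIV"
    (is "\<exists>d. real d = ?v \<and> regular_analytic_submanifold d ?S UNIV")
proof (rule regular_analytic_submanifoldI)
  let ?c = "real CARD('k) / real CARD('n)"
  obtain F :: "'a^'n^'k" where F: "\<And>i. norm (F $ i) = 1" "adj F ** F = ?c *\<^sub>R mat 1"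
    using spherical_frame_exists[OF nk] by blast
  note P = frame_gram_projection[OF F refl]
  have "rank ((1 / ?c) *\<^sub>R (F ** adj F)) = CARD('n)"
    using trace_idempotent[OF P(2)] trace_const_diag[OF P(3)] by (metis of_nat_eq_iff)
  then show "?S \<noteq> {}" using P by blast
  show "?S \<subseteq> UNIV" by simp
next
  fix p assume "p \<in> ?S"
  then obtain P :: "'a^'k^'k" where p: "p = (real CARD('k) / real CARD('n)) *\<^sub>R P" and P: "adj P = P" "P ** P = P"
     "\<And>i. P $ i $ i = of_real (real CARD('n) / real CARD('k))" by blast
  show "\<exists>U \<phi> V W L. p \<in> U \<and> analytic_chart UNIV U \<phi> V W \<and> subspace L \<and> L \<subseteq> W \<and>
      real (dim L) = ?v \<and> \<phi> ` (U \<inter> ?S) = V \<inter> L"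
    unfolding p by (rule gram_chart[OF _ nk cop refl P]) simp
qed

end

section \<open>The real and the complex case\<close>

lemma conj_field_real: "conj_field (\<lambda>x::real. x)"
  by unfold_locales auto

lemma conj_field_complex: "conj_field cnj"
proof
  show "x = of_real (1 \<bullet> x)" if "cnj x = x" for x
    using that by (simp add: complex_eq_iff inner_complex_def)
  show "(\<Sum>u\<in>Basis. cnj u \<bullet> u) = 2 - real DIM(complex)"
    by (simp add: Basis_complex_def inner_complex_def)
qed (simp_all add: inner_complex_def)

lemma adj_real: "conj_field.adj (\<lambda>x::real. x) = transpose"
  by (simp add: fun_eq_iff conj_field.adj_def[OF conj_field_real] transpose_def)

lemma adj_complex: "conj_field.adj cnj = adjoint_matrix"
  by (simp add: fun_eq_iff conj_field.adj_def[OF conj_field_complex] adjoint_matrix_def)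

theorem theorem4p3:
  fixes n k :: nat
  assumes "CARD('n::finite) = n" and "CARD('k::finite) = k"
    and "k > n" and "coprime n k"
  shows
    "(\<exists>d. real d = (real k - real n - 1) * (real n - 1) \<and>
        regular_analytic_submanifold d (gram_matrices_real n :: (real^'k^'k) set) UNIV) \<and>
     (\<exists>d. real d = (real k - real n / 2 - 1) * (real n - 1) \<and>
        regular_analytic_submanifold d
          (spherical_tight_frames_real :: ((real^'n)^'k) set) sphere_power) \<and>
     (\<exists>d. real d = 2 * real n * (real k - real n) - real k + 1 \<and>
        regular_analytic_submanifold d (gram_matrices_complex n :: (complex^'k^'k) set) UNIV) \<and>
     (\<exists>d. real d = 2 * real n * (real k - real n) + (real n)\<^sup>2 - real k + 1 \<and>
        regular_analytic_submanifold d
          (spherical_tight_frames_complex :: ((complex^'n)^'k) set) sphere_power)"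
proof -
  have cop: "coprime CARD('n) CARD('k)" and nk: "CARD('n) < CARD('k)" using assms by simp_all
  have n: "real CARD('n) = real n" and k: "real CARD('k) = real k" using assms by simp_all
  show ?thesis
  proof (intro conjI)
  have "(gram_matrices_real n :: (real^'k^'k) set) = {(real CARD('k) / real CARD('n)) *\<^sub>R P | P.
       conj_field.adj (\<lambda>x. x) P = P \<and> P ** P = P \<and> rank P = CARD('n) \<and>
       (\<forall>i. P $ i $ i = of_real (real CARD('n) / real CARD('k)))}"
    unfolding gram_matrices_real_def adj_real by (simp add: assms(1))
  moreover have "DIM(real) * real CARD('n) * (real CARD('k) - real CARD('n)) - real CARD('k) + 1
      = (real k - real n - 1) * (real n - 1)"
    unfolding n k by (simp add: algebra_simps)
  ultimately show "\<exists>d. real d = (real k - real n - 1) * (real n - 1) \<and>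
        regular_analytic_submanifold d (gram_matrices_real n :: (real^'k^'k) set) UNIV"
    using conj_field.gram_matrices_submanifold[OF conj_field_real cop nk] by (simp only:)
next
  have "(spherical_tight_frames_real :: ((real^'n)^'k) set) = {F. F \<in> sphere_power \<and>
       (\<exists>B>0. \<forall>v. (\<Sum>i\<in>UNIV. (norm (\<Sum>j\<in>UNIV. v $ j * F $ i $ j))\<^sup>2) = B * (norm v)\<^sup>2)}"
    unfolding spherical_tight_frames_real_def inner_vec_def inner_real_def real_norm_def ..
  moreover have "DIM(real) * real CARD('n) * real CARD('k) - real CARD('k)
         - (DIM(real) * (real CARD('n))\<^sup>2 + CARD('n) * (2 - real DIM(real))) / 2 + 1
      = (real k - real n / 2 - 1) * (real n - 1)"
    unfolding n k by (simp add: field_simps power2_eq_square)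
  ultimately show "\<exists>d. real d = (real k - real n / 2 - 1) * (real n - 1) \<and>
        regular_analytic_submanifold d
          (spherical_tight_frames_real :: ((real^'n)^'k) set) sphere_power"
    using conj_field.tight_frames_submanifold[OF conj_field_real cop nk] by (simp only:)
next
  have "(gram_matrices_complex n :: (complex^'k^'k) set) = {(real CARD('k) / real CARD('n)) *\<^sub>R P | P.
       conj_field.adj cnj P = P \<and> P ** P = P \<and> rank P = CARD('n) \<and>
       (\<forall>i. P $ i $ i = of_real (real CARD('n) / real CARD('k)))}"
    unfolding gram_matrices_complex_def adj_complex by (simp add: assms(1))
  moreover have "DIM(complex) * real CARD('n) * (real CARD('k) - real CARD('n)) - real CARD('k) + 1
      = 2 * real n * (real k - real n) - real k + 1"
    unfolding n k by simp
  ultimately show "\<exists>d. real d = 2 * real n * (real k - real n) - real k + 1 \<and>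
        regular_analytic_submanifold d (gram_matrices_complex n :: (complex^'k^'k) set) UNIV"
    using conj_field.gram_matrices_submanifold[OF conj_field_complex cop nk] by (simp only:)
next
  have "(spherical_tight_frames_complex :: ((complex^'n)^'k) set) = {F. F \<in> sphere_power \<and>
       (\<exists>B>0. \<forall>v. (\<Sum>i\<in>UNIV. (norm (\<Sum>j\<in>UNIV. v $ j * cnj (F $ i $ j)))\<^sup>2) = B * (norm v)\<^sup>2)}"
    unfolding spherical_tight_frames_complex_def cinner_def ..
  moreover have "DIM(complex) * real CARD('n) * real CARD('k) - real CARD('k)
         - (DIM(complex) * (real CARD('n))\<^sup>2 + CARD('n) * (2 - real DIM(complex))) / 2 + 1
      = 2 * real n * (real k - real n) + (real n)\<^sup>2 - real k + 1"
    unfolding n k by (simp add: field_simps power2_eq_square)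
  ultimately show "\<exists>d. real d = 2 * real n * (real k - real n) + (real n)\<^sup>2 - real k + 1 \<and>
        regular_analytic_submanifold d
          (spherical_tight_frames_complex :: ((complex^'n)^'k) set) sphere_power"
    using conj_field.tight_frames_submanifold[OF conj_field_complex cop nk] by (simp only:)
  qed
qed

end
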